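(* Let $\alpha: G \to \mathrm{Aut}(A)$ be an action of a discrete group $G$ on a unital $C^*$-algebra $A$, let $\psi: G\to A$, and consider the following two claims: (i) $\psi$ is $\alpha$-negative definite; (ii) $e^{-t\psi}$ is $\alpha$-positive definite for all $t>0$. Then (ii) implies (i). Moreover, suppose that $\psi$ is $Z(A)$-valued. Then (i) implies (ii). Thus, in this case, (i) and (ii) are equivalent.
   Context: $Z(A)$ denotes the center of $A$. The function $e^{-t\psi}: G\to A$ is defined by $g\mapsto e^{-t\psi(g)}$ (exponential in the unital $C^*$-algebra $A$). A function $\varphi: G\to A$ is $\alpha$-positive definite if for any $n\in\mathbb{N}$ and $g_1,\dots,g_n\in G$ the matrix $\big[\alpha_{g_i}(\varphi(g_i^{-1}g_j))\big]$ is positive in $M_n(A)$. A function $\psi: G\to A$ is $\alpha$-negative definite if $\alpha_g(\psi(g^{-1})) = \psi(g)^*$ for all $g\in G$ and, for any $n\in\mathbb{N}$, $g_1,\dots,g_n\in G$ and $b_1,\dots,b_n\in A$ with $\sum_{i=1}^n b_i = 0$, one has $\sum_{i,j=1}^n b_i^*\,\alpha_{g_i}\big(\psi(g_i^{-1}g_j)\big)\,b_j \leq 0$ in $A$. *)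

theory Defs
  imports
    "HOL-Analysis.Analysis"
    "HOL-Algebra.Group_Action"
    "Jordan_Normal_Form.Matrix"
begin

text \<open>
  Unital complex \<open>C\<^sup>*\<close>-algebras. The real Banach algebra structure, including \<open>norm 1 = 1\<close>
  (hence \<open>1 \<noteq> 0\<close>), comes from the library classes; the complex scalar multiplication extends
  the real one.
\<close>

class cstar_algebra = real_normed_algebra_1 + banach +
  fixes scaleC :: "complex \<Rightarrow> 'a \<Rightarrow> 'a"  (infixr \<open>*\<^sub>C\<close> 75)
    and star :: "'a \<Rightarrow> 'a"
  assumes scaleC_add_right: "c *\<^sub>C (a + b) = c *\<^sub>C a + c *\<^sub>C b"
    and scaleC_add_left: "(c + d) *\<^sub>C a = c *\<^sub>C a + d *\<^sub>C a"
    and scaleC_scaleC: "c *\<^sub>C (d *\<^sub>C a) = (c * d) *\<^sub>C a"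
    and scaleC_of_real: "complex_of_real r *\<^sub>C a = r *\<^sub>R a"
    and mult_scaleC_left: "(c *\<^sub>C a) * b = c *\<^sub>C (a * b)"
    and mult_scaleC_right: "a * (c *\<^sub>C b) = c *\<^sub>C (a * b)"
    and norm_scaleC: "norm (c *\<^sub>C a) = cmod c * norm a"
    and star_add: "star (a + b) = star a + star b"
    and star_scaleC: "star (c *\<^sub>C a) = cnj c *\<^sub>C star a"
    and star_mult: "star (a * b) = star b * star a"
    and star_star: "star (star a) = a"
    and cstar_identity: "norm (star a * a) = (norm a)\<^sup>2"

instantiation complex :: cstar_algebra
begin

definition scaleC_complex :: "complex \<Rightarrow> complex \<Rightarrow> complex"
  where "scaleC_complex c a = c * a"

definition star_complex :: "complex \<Rightarrow> complex"
  where "star_complex = cnj"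

instance
  by standard
    (auto simp: scaleC_complex_def star_complex_def algebra_simps scaleR_conv_of_real
      norm_mult power2_eq_square)

end

definition cstar_center :: "'a::cstar_algebra set"
  where "cstar_center = {z. \<forall>a. z * a = a * z}"

text \<open>
  Positivity in a \<open>C\<^sup>*\<close>-algebra is taken in the form \<open>b\<^sup>* b\<close>, which refers to the
  \<open>*\<close>-algebra structure only and so applies verbatim to the matrix algebra \<open>M\<^sub>n(A)\<close>
  without first constructing its \<open>C\<^sup>*\<close>-norm.
\<close>

definition cstar_pos :: "'a::cstar_algebra \<Rightarrow> bool"
  where "cstar_pos a \<longleftrightarrow> (\<exists>b. a = star b * b)"

definition cstar_le :: "'a::cstar_algebra \<Rightarrow> 'a \<Rightarrow> bool"
  where "cstar_le a b \<longleftrightarrow> cstar_pos (b - a)"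

definition mat_star :: "'a::cstar_algebra mat \<Rightarrow> 'a mat"
  where "mat_star B = map_mat star (transpose_mat B)"

definition mat_pos :: "nat \<Rightarrow> 'a::cstar_algebra mat \<Rightarrow> bool"
  where "mat_pos n M \<longleftrightarrow> (\<exists>B \<in> carrier_mat n n. M = mat_star B * B)"

definition star_automorphism :: "('a::cstar_algebra \<Rightarrow> 'a) \<Rightarrow> bool"
  where "star_automorphism f \<longleftrightarrow>
    bij f \<and>
    (\<forall>a b. f (a + b) = f a + f b) \<and>
    (\<forall>c a. f (c *\<^sub>C a) = c *\<^sub>C f a) \<and>
    (\<forall>a b. f (a * b) = f a * f b) \<and>
    (\<forall>a. f (star a) = star (f a))"

definition cstar_action :: "('g, 'm) monoid_scheme \<Rightarrow> ('g \<Rightarrow> 'a::cstar_algebra \<Rightarrow> 'a) \<Rightarrow> bool"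
  where "cstar_action G \<alpha> \<longleftrightarrow>
    group_action G UNIV \<alpha> \<and> (\<forall>g \<in> carrier G. star_automorphism (\<alpha> g))"

definition positive_definite ::
    "('g, 'm) monoid_scheme \<Rightarrow> ('g \<Rightarrow> 'a::cstar_algebra \<Rightarrow> 'a) \<Rightarrow> ('g \<Rightarrow> 'a) \<Rightarrow> bool"
  where "positive_definite G \<alpha> \<phi> \<longleftrightarrow>
    (\<forall>n. \<forall>g :: nat \<Rightarrow> 'g. (\<forall>i<n. g i \<in> carrier G) \<longrightarrow>
      mat_pos n (mat n n (\<lambda>(i, j). \<alpha> (g i) (\<phi> (inv\<^bsub>G\<^esub> (g i) \<otimes>\<^bsub>G\<^esub> g j)))))"

definition negative_definite ::
    "('g, 'm) monoid_scheme \<Rightarrow> ('g \<Rightarrow> 'a::cstar_algebra \<Rightarrow> 'a) \<Rightarrow> ('g \<Rightarrow> 'a) \<Rightarrow> bool"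
  where "negative_definite G \<alpha> \<psi> \<longleftrightarrow>
    (\<forall>g \<in> carrier G. \<alpha> g (\<psi> (inv\<^bsub>G\<^esub> g)) = star (\<psi> g)) \<and>
    (\<forall>n. \<forall>g :: nat \<Rightarrow> 'g. \<forall>b :: nat \<Rightarrow> 'a.
      (\<forall>i<n. g i \<in> carrier G) \<longrightarrow> (\<Sum>i<n. b i) = 0 \<longrightarrow>
      cstar_le
        (\<Sum>i<n. \<Sum>j<n. star (b i) * \<alpha> (g i) (\<psi> (inv\<^bsub>G\<^esub> (g i) \<otimes>\<^bsub>G\<^esub> g j)) * b j) 0)"

end

theory Submission
  imports Defs
begin

text \<open>
  Fix group elements \<open>g\<^sub>i\<close> and let \<open>K\<^sub>i\<^sub>j = \<alpha>\<^sub>g\<^sub>i(\<psi>(g\<^sub>i\<^sup>-\<^sup>1 g\<^sub>j))\<close>. Since each \<open>\<alpha>\<^sub>g\<close> is continuous and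
  multiplicative, the theorem compares the self-adjoint, conditionally negative matrices \<open>K\<close> with
  the positive matrices \<open>exp (- t K\<^sub>i\<^sub>j)\<close>, and it is Schoenberg's theorem with values in \<open>A\<close>.

  From (ii) to (i) one differentiates at \<open>t = 0\<close> (\<open>cond_neg_kernel_if_exp_pos\<close>). This uses that the
  positive cone of \<open>A\<close> is closed and that the involution is continuous.

  From (i) to (ii) one adds a base point \<open>n\<close>. Conditional negativity says that
  \<open>L\<^sub>i\<^sub>j = K\<^sub>i\<^sub>n + K\<^sub>n\<^sub>j - K\<^sub>i\<^sub>j - K\<^sub>n\<^sub>n\<close> is positive (\<open>centered_kernel_pos\<close>). The entries are central,
  so Schur products of positive matrices are positive (\<open>pos_kernel_schur\<close>); hence so is the
  entrywise exponential of \<open>t L\<close>, and \<open>exp (- t K\<^sub>i\<^sub>j)\<close> differs from it by factors \<open>d\<^sub>i\<^sup>*\<close> on the left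
  and \<open>d\<^sub>j\<close> on the right (\<open>exp_pos_if_cond_neg_kernel\<close>).

  Both directions rest on two facts about positivity. The first is that the elements \<open>b\<^sup>* b\<close> of \<open>A\<close>
  form a closed convex cone on which the norm is monotone. It is proved without spectral theory:
  the binomial series of \<open>\<surd>(1 - x)\<close> converges for \<open>\<parallel>x\<parallel> \<le> 1\<close> and gives square roots, and a
  self-adjoint \<open>x\<close> with \<open>x\<^sup>2 + y\<^sup>2 = 1\<close> for a commuting self-adjoint \<open>y\<close> has norm at most \<open>1\<close>
  because \<open>x + i y\<close> is unitary. The second is that a matrix is of the form \<open>B\<^sup>* B\<close> exactly if
  its \<open>A\<close>-valued quadratic form is positive (\<open>mat_pos_iff_pos_kernel\<close>). Instead of a norm on
  \<open>M\<^sub>n(A)\<close> it uses that \<open>- 1 \<le> X \<le> 1\<close> bounds the entries of all powers of \<open>X\<close>, so the same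
  series can be summed entrywise.
\<close>

section \<open>The binomial series of the square root\<close>

text \<open>
  The Taylor coefficients of \<open>\<surd>(1 - x)\<close>. All of them but the first are non-positive, and their
  partial sums are non-negative, so the series converges absolutely on the whole closed unit ball
  and \<open>\<bar>1 - \<surd>(1 - x)\<bar> \<le> 1\<close> there.
\<close>

definition sqrt_coeff :: "nat \<Rightarrow> real" where
  "sqrt_coeff k = (-1) ^ k * ((1/2) gchoose k)"

lemma sqrt_coeff_0 [simp]: "sqrt_coeff 0 = 1"
  by (simp add: sqrt_coeff_def)

lemma sqrt_coeff_nonpos: "sqrt_coeff (Suc k) \<le> 0"
proof -
  have "sqrt_coeff (Suc k) = pochhammer (- (1/2)) (Suc k) / fact (Suc k)"
    by (simp add: sqrt_coeff_def gbinomial_pochhammer del: fact_Suc flip: power_add mult.assoc)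
  also have "\<dots> = - (1/2) * pochhammer (1/2) k / fact (Suc k)"
    by (simp add: pochhammer_rec del: fact_Suc)
  also have "\<dots> \<le> 0"
    using pochhammer_nonneg[of "1/2::real" k] by (simp add: divide_nonneg_pos del: fact_Suc)
  finally show ?thesis .
qed

lemma sqrt_coeff_partial_sum: "0 \<le> (\<Sum>k\<le>m. sqrt_coeff k)"
proof -
  have "(\<Sum>k\<le>m. sqrt_coeff k) = (\<Sum>k\<le>m. ((1/2) gchoose k) * (-1) ^ k)"
    by (simp add: sqrt_coeff_def mult.commute)
  also have "\<dots> = (-1) ^ m * ((- (1/2)) gchoose m)"
    by (subst gbinomial_sum_lower_neg) simp
  also have "\<dots> = pochhammer (1/2) m / fact m"
    by (simp add: gbinomial_pochhammer flip: power_add mult.assoc)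
  also have "\<dots> \<ge> 0"
    using pochhammer_nonneg[of "1/2::real" m] by simp
  finally show ?thesis .
qed

lemma sqrt_coeff_tail:
  shows summable_sqrt_coeff_tail: "summable (\<lambda>k. \<bar>sqrt_coeff (Suc k)\<bar>)"
    and suminf_sqrt_coeff_tail: "(\<Sum>k. \<bar>sqrt_coeff (Suc k)\<bar>) \<le> 1"
proof -
  have bd: "(\<Sum>k<m. \<bar>sqrt_coeff (Suc k)\<bar>) \<le> 1" for m
  proof -
    have "(\<Sum>k<m. \<bar>sqrt_coeff (Suc k)\<bar>) = 1 - (\<Sum>k\<le>m. sqrt_coeff k)"
      by (simp add: abs_of_nonpos sqrt_coeff_nonpos sum_negf sum.atMost_shift)
    then show ?thesis
      using sqrt_coeff_partial_sum[of m] by simp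
  qed
  then show "summable (\<lambda>k. \<bar>sqrt_coeff (Suc k)\<bar>)"
    by (intro summableI_nonneg_bounded[where x = 1]) auto
  then show "(\<Sum>k. \<bar>sqrt_coeff (Suc k)\<bar>) \<le> 1"
    using bd by (intro suminf_le_const)
qed

lemma summable_sqrt_coeff: "summable (\<lambda>k. \<bar>sqrt_coeff k\<bar>)"
  using summable_sqrt_coeff_tail by (subst (asm) summable_Suc_iff)

lemma sqrt_coeff_convolution:
  "(\<Sum>m\<le>k. sqrt_coeff m * sqrt_coeff (k - m)) = (if k = 0 then 1 else if k = 1 then - 1 else 0)"
proof -
  have "(\<Sum>m\<le>k. sqrt_coeff m * sqrt_coeff (k - m))
      = (\<Sum>m\<le>k. (-1) ^ k * (((1/2) gchoose m) * ((1/2) gchoose (k - m))))"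
    by (intro sum.cong refl) (simp add: sqrt_coeff_def flip: power_add)
  also have "\<dots> = (-1) ^ k * (1 gchoose k)"
    using gbinomial_Vandermonde[of "1/2::real" "1/2" k]
    by (simp add: atMost_atLeast0 flip: sum_distrib_left)
  also have "(1::real) gchoose k = of_nat (1 choose k)"
    by (metis binomial_gbinomial of_nat_1)
  finally show ?thesis
    by (auto simp: binomial_eq_0)
qed

lemma sqrt_series_sums:
  fixes u :: "nat \<Rightarrow> 'a::banach"
  assumes "\<And>k. norm (u k) \<le> B"
  shows summable_norm_sqrt_series: "summable (\<lambda>k. norm (sqrt_coeff k *\<^sub>R u k))"
    and summable_sqrt_series: "summable (\<lambda>k. sqrt_coeff k *\<^sub>R u k)"
proof -
  show "summable (\<lambda>k. norm (sqrt_coeff k *\<^sub>R u k))"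
    by (rule summable_comparison_test'[OF summable_mult2[OF summable_sqrt_coeff, of B], of 0])
      (auto intro!: mult_left_mono assms)
  then show "summable (\<lambda>k. sqrt_coeff k *\<^sub>R u k)"
    by (rule summable_norm_cancel)
qed

text \<open>
  The Cauchy product of two such series. The coefficients are multiplied with arbitrary bounded
  sequences and not only with powers of one element: the entries of the powers of a matrix are
  such sequences, so the same lemma yields square roots of matrices.
\<close>

lemma sqrt_series_mult:
  fixes u v :: "nat \<Rightarrow> 'a::{real_normed_algebra,banach}"
  assumes "\<And>k. norm (u k) \<le> B" "\<And>k. norm (v k) \<le> B"
  shows "(\<lambda>k. \<Sum>m\<le>k. (sqrt_coeff m * sqrt_coeff (k - m)) *\<^sub>R (u m * v (k - m))) sums
    ((\<Sum>k. sqrt_coeff k *\<^sub>R u k) * (\<Sum>k. sqrt_coeff k *\<^sub>R v k))"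
  using Cauchy_product_sums[OF summable_norm_sqrt_series[of u, OF assms(1)]
      summable_norm_sqrt_series[of v, OF assms(2)]]
  by (simp add: mult.commute)

text \<open>
  This evaluates the Cauchy product when the term of degree \<open>k\<close> depends on \<open>k\<close> only, since
  \<open>\<surd>(1 - x) * \<surd>(1 - x) = 1 - x\<close>.
\<close>

lemma sqrt_series_square_sums:
  fixes p :: "nat \<Rightarrow> 'a::banach"
  shows "(\<lambda>k. \<Sum>m\<le>k. (sqrt_coeff m * sqrt_coeff (k - m)) *\<^sub>R p k) sums (p 0 - p 1)"
proof -
  have "(\<lambda>k. \<Sum>m\<le>k. (sqrt_coeff m * sqrt_coeff (k - m)) *\<^sub>R p k)
      = (\<lambda>k. (if k = 0 then 1 else if k = 1 then - 1 else 0 :: real) *\<^sub>R p k)"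
    by (simp add: sqrt_coeff_convolution flip: scaleR_sum_left)
  also have "\<dots> sums (\<Sum>k\<in>{0,1}. (if k = 0 then 1 else if k = 1 then - 1 else 0 :: real) *\<^sub>R p k)"
    by (rule sums_finite) auto
  finally show ?thesis by simp
qed

section \<open>The involution\<close>

lemma scaleC_minus_1: "(-1) *\<^sub>C a = - (a::'a::cstar_algebra)"
  using scaleC_of_real[of "-1" a] by simp

lemma scaleC_minus_left: "(- z) *\<^sub>C a = - (z *\<^sub>C (a::'a::cstar_algebra))"
  using scaleC_scaleC[of "-1" z a] by (simp add: scaleC_minus_1)

lemma scaleC_diff_right: "z *\<^sub>C (a - b) = z *\<^sub>C a - z *\<^sub>C (b::'a::cstar_algebra)"
  using scaleC_add_right[of z "a - b" b] by (simp add: algebra_simps)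

lemma star_scaleR: "star (r *\<^sub>R a) = r *\<^sub>R star (a::'a::cstar_algebra)"
  by (metis complex_cnj_complex_of_real scaleC_of_real star_scaleC)

lemma star_0 [simp]: "star (0::'a::cstar_algebra) = 0"
  using star_scaleR[of 0 "0::'a"] by simp

lemma star_minus: "star (- a) = - star (a::'a::cstar_algebra)"
  using star_scaleR[of "-1" a] by simp

lemma star_diff: "star (a - b) = star a - star (b::'a::cstar_algebra)"
  using star_add[of a "- b"] by (simp add: star_minus)

lemma star_1 [simp]: "star (1::'a::cstar_algebra) = 1"
  using star_mult[of "star (1::'a)" 1] by (simp add: star_star)

lemma star_sum: "star (sum f I) = (\<Sum>i\<in>I. star (f i :: 'a::cstar_algebra))"
  by (induction I rule: infinite_finite_induct) (auto simp: star_add)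

lemma star_power: "star (a ^ n) = star (a::'a::cstar_algebra) ^ n"
  by (induction n) (auto simp: star_mult power_commutes)

text \<open>
  One half of the isometry is \<open>\<parallel>b\<parallel>\<^sup>2 = \<parallel>b\<^sup>* b\<parallel> \<le> \<parallel>b\<^sup>*\<parallel> \<parallel>b\<parallel>\<close>; the other half is the same
  inequality for \<open>b\<^sup>*\<close>.
\<close>

lemma norm_star: "norm (star a) = norm (a::'a::cstar_algebra)"
proof -
  have le: "norm b \<le> norm (star b)" for b :: 'a
  proof (cases "b = 0")
    case False
    have "(norm b)\<^sup>2 \<le> norm (star b) * norm b"
      by (metis cstar_identity norm_mult_ineq)
    then show ?thesis
      using False by (simp add: power2_eq_square)
  qed simp
  from le[of a] le[of "star a"] show ?thesis
    by (simp add: star_star)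
qed

lemma bounded_linear_star: "bounded_linear (star :: 'a::cstar_algebra \<Rightarrow> 'a)"
  by (rule bounded_linear_intro[where K = 1]) (simp_all add: star_add star_scaleR norm_star)

section \<open>The positive cone of a \<open>C\<^sup>*\<close>-algebra\<close>

text \<open>
  A self-adjoint element has its spectrum in the half line \<open>[0, \<infinity>)\<close> exactly if it lies in a ball of
  radius \<open>c\<close> around \<open>c\<close>. In this form, closure under sums is the triangle inequality and no
  spectrum is needed. The agreement with the elements \<open>b\<^sup>* b\<close> is the main result of this part.
\<close>

definition norm_pos :: "'a::cstar_algebra \<Rightarrow> bool" where
  "norm_pos a \<longleftrightarrow> star a = a \<and> (\<exists>c\<ge>0. norm (c *\<^sub>R 1 - a) \<le> c)"

lemma norm_pos_star: "norm_pos a \<Longrightarrow> star a = a"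
  by (simp add: norm_pos_def)

lemma norm_pos_add:
  assumes "norm_pos a" "norm_pos b"
  shows "norm_pos (a + b)"
proof -
  obtain c d where *: "c \<ge> 0" "norm (c *\<^sub>R 1 - a) \<le> c" "d \<ge> 0" "norm (d *\<^sub>R 1 - b) \<le> d"
    using assms by (auto simp: norm_pos_def)
  have "norm ((c + d) *\<^sub>R 1 - (a + b)) = norm ((c *\<^sub>R 1 - a) + (d *\<^sub>R 1 - b))"
    by (simp add: algebra_simps)
  also have "\<dots> \<le> c + d"
    using * norm_triangle_ineq[of "c *\<^sub>R 1 - a" "d *\<^sub>R 1 - b"] by linarith
  finally show ?thesis
    using assms * unfolding norm_pos_def by (intro conjI exI[of _ "c + d"]) (auto simp: star_add)
qed

lemma norm_pos_scaleR:
  assumes "norm_pos a" "r \<ge> 0"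
  shows "norm_pos (r *\<^sub>R a)"
proof -
  obtain c where *: "c \<ge> 0" "norm (c *\<^sub>R 1 - a) \<le> c"
    using assms by (auto simp: norm_pos_def)
  have "norm ((r * c) *\<^sub>R 1 - r *\<^sub>R a) = norm (r *\<^sub>R (c *\<^sub>R 1 - a))"
    by (simp add: algebra_simps)
  also have "\<dots> \<le> r * c"
    using * assms by (simp add: mult_left_mono)
  finally show ?thesis
    using assms * unfolding norm_pos_def by (intro conjI exI[of _ "r * c"]) (auto simp: star_scaleR)
qed

text \<open>
  The root is the binomial series in \<open>x\<close>. It lies in the cone because all of its terms but the
  leading \<open>1\<close> add up to an element of norm at most \<open>1\<close>.
\<close>

lemma sqrt_one_minus_exists:
  fixes x :: "'a::cstar_algebra"
  assumes "star x = x" "norm x \<le> 1"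
  shows "\<exists>s. norm_pos s \<and> s * s = 1 - x \<and> (\<forall>y. y * x = x * y \<longrightarrow> y * s = s * y)"
proof (intro exI conjI allI impI)
  let ?s = "\<Sum>k. sqrt_coeff k *\<^sub>R x ^ k"
  have bd: "norm (x ^ k) \<le> 1" for k
    using norm_power_ineq[of x k] power_le_one[of "norm x" k] assms(2) by simp
  note summ = summable_sqrt_series[of "\<lambda>k. x ^ k", OF bd]
  have "star ?s = ?s"
    by (subst bounded_linear.suminf[OF bounded_linear_star summ])
      (simp add: star_scaleR star_power assms)
  moreover have "norm (1 *\<^sub>R 1 - ?s) \<le> 1"
  proof -
    have "?s - 1 = (\<Sum>k. sqrt_coeff (Suc k) *\<^sub>R x ^ Suc k)"
      by (subst suminf_split_head[OF summ]) simp
    also have "norm \<dots> \<le> (\<Sum>k. \<bar>sqrt_coeff (Suc k)\<bar>)"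
      by (rule norm_suminf_le[OF _ summable_sqrt_coeff_tail])
        (use mult_left_mono[OF bd, OF abs_ge_zero] in \<open>simp only: norm_scaleR mult_1_right\<close>)
    finally show ?thesis
      using suminf_sqrt_coeff_tail by (simp add: norm_minus_commute)
  qed
  ultimately show "norm_pos ?s"
    unfolding norm_pos_def by (intro conjI exI[of _ 1]) auto
  show "?s * ?s = 1 - x"
  proof -
    have "(\<lambda>k. \<Sum>m\<le>k. (sqrt_coeff m * sqrt_coeff (k - m)) *\<^sub>R x ^ k) sums (?s * ?s)"
      using sqrt_series_mult[of "\<lambda>k. x ^ k" _ "\<lambda>k. x ^ k", OF bd bd] by (simp flip: power_add)
    from sums_unique2[OF this sqrt_series_square_sums] show ?thesis by simp
  qed
  fix y assume y: "y * x = x * y"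
  have "y * x ^ k = x ^ k * y" for k
    using power_commuting_commutes[OF y[symmetric], of k] by simp
  then show "y * ?s = ?s * y"
    by (simp add: suminf_mult2[OF summ] flip: suminf_mult[OF summ])
qed

text \<open>
  Scaling: if \<open>a\<close> lies in the ball of radius \<open>c\<close> around \<open>c\<close>, then \<open>a = c (1 - x)\<close> with
  \<open>\<parallel>x\<parallel> \<le> 1\<close>.
\<close>

lemma norm_pos_sqrt:
  fixes a :: "'a::cstar_algebra"
  assumes "norm_pos a"
  shows "\<exists>s. norm_pos s \<and> s * s = a \<and> (\<forall>y. y * a = a * y \<longrightarrow> y * s = s * y)"
proof -
  obtain c where c: "c \<ge> 0" "norm (c *\<^sub>R 1 - a) \<le> c" and sa: "star a = a"
    using assms by (auto simp: norm_pos_def)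
  show ?thesis
  proof (cases "c = 0")
    case True
    then show ?thesis using assms c by (intro exI[of _ 0]) auto
  next
    case False
    with c have "c > 0" by simp
    define x where "x = 1 - (1/c) *\<^sub>R a"
    have a: "a = c *\<^sub>R (1 - x)"
      using \<open>c > 0\<close> by (simp add: x_def)
    have "x = (1/c) *\<^sub>R (c *\<^sub>R 1 - a)"
      using \<open>c > 0\<close> by (simp add: x_def algebra_simps)
    then have "norm x \<le> 1"
      using c \<open>c > 0\<close> by simp
    moreover have "star x = x"
      by (simp add: x_def star_diff star_scaleR sa)
    ultimately obtain s where s: "norm_pos s" "s * s = 1 - x" "\<And>y. y * x = x * y \<Longrightarrow> y * s = s * y"
      using sqrt_one_minus_exists by blast
    show ?thesis
    proof (intro exI[of _ "sqrt c *\<^sub>R s"] conjI allI impI)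
      show "norm_pos (sqrt c *\<^sub>R s)"
        using s(1) c by (intro norm_pos_scaleR) auto
      show "(sqrt c *\<^sub>R s) * (sqrt c *\<^sub>R s) = a"
        using c by (simp add: s(2) a)
      fix y assume "y * a = a * y"
      then have "y * x = x * y"
        by (simp add: x_def algebra_simps)
      then show "y * (sqrt c *\<^sub>R s) = (sqrt c *\<^sub>R s) * y"
        using s(3) by simp
    qed
  qed
qed

text \<open>
  The element \<open>u = x + i y\<close> satisfies \<open>u\<^sup>* u = 1\<close>, hence \<open>\<parallel>u\<parallel> = \<parallel>u\<^sup>*\<parallel> = 1\<close>, and \<open>x\<close> is the mean
  of \<open>u\<close> and \<open>u\<^sup>*\<close>. This replaces the functional calculus in the rest of this part.
\<close>

lemma norm_le_1_if_squares_sum_to_1: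
  fixes x y :: "'a::cstar_algebra"
  assumes "star x = x" "star y = y" "x * y = y * x" "x * x + y * y = 1"
  shows "norm x \<le> 1"
proof -
  define u where "u = x + \<i> *\<^sub>C y"
  have star_u: "star u = x + (- \<i>) *\<^sub>C y"
    by (simp add: u_def star_add star_scaleC assms)
  have "star u * u = x * x + y * y"
    by (simp add: star_u scaleC_minus_left) (simp add: u_def algebra_simps mult_scaleC_left
        mult_scaleC_right scaleC_scaleC scaleC_minus_1 scaleC_diff_right scaleC_add_right assms(3))
  then have "(norm u)\<^sup>2 = 1"
    using cstar_identity[of u] assms(4) by simp
  then have "norm u = 1"
    by (simp add: power2_eq_1_iff) (metis norm_ge_zero not_one_le_zero neg_0_le_iff_le)
  have "2 *\<^sub>R x = u + star u"
    by (simp add: star_u scaleC_minus_left) (simp add: u_def scaleR_2)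
  then have "2 * norm x \<le> norm u + norm (star u)"
    by (metis norm_scaleR norm_triangle_ineq abs_numeral)
  then show ?thesis
    by (simp add: norm_star \<open>norm u = 1\<close>)
qed

text \<open>
  After scaling to \<open>c = 1\<close>, write \<open>1 - s\<^sup>2 = r\<^sup>2\<close> with \<open>r\<close> self-adjoint and commuting with \<open>s\<close>. Then
  \<open>r\<^sup>2 + s\<^sup>2 = 1\<close> gives \<open>\<parallel>r\<parallel> \<le> 1\<close>. In particular, squares of self-adjoint elements lie in the cone.
\<close>

lemma norm_diff_square_le:
  fixes s :: "'a::cstar_algebra"
  assumes "star s = s" "norm (s * s) \<le> c"
  shows "norm (c *\<^sub>R 1 - s * s) \<le> c"
proof (cases "c = 0")
  case False
  then have "c > 0"
    using assms(2) norm_ge_zero[of "s * s"] by linarith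
  define x where "x = (1 / sqrt c) *\<^sub>R s"
  have sx: "star x = x"
    by (simp add: x_def star_scaleR assms)
  have xx: "x * x = (1 / c) *\<^sub>R (s * s)"
    using \<open>c > 0\<close> by (simp add: x_def)
  have "norm (x * x) \<le> 1"
    using \<open>c > 0\<close> assms(2) by (simp add: xx)
  moreover have "star (x * x) = x * x"
    by (simp add: star_mult sx)
  ultimately obtain r where r: "norm_pos r" "r * r = 1 - x * x" "\<And>y. y * (x * x) = x * x * y \<Longrightarrow> y * r = r * y"
    using sqrt_one_minus_exists by blast
  have "norm r \<le> 1"
    using r(1,2) r(3)[of x]
    by (intro norm_le_1_if_squares_sum_to_1[of r x]) (auto simp: norm_pos_star sx mult.assoc)
  then have "norm (r * r) \<le> 1"
    using norm_mult_ineq[of r r] mult_le_one[of "norm r" "norm r"] by simp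
  moreover have "c *\<^sub>R 1 - s * s = c *\<^sub>R (r * r)"
    using \<open>c > 0\<close> by (simp add: r(2) xx algebra_simps)
  ultimately show ?thesis
    using \<open>c > 0\<close> by simp
qed (use assms in auto)

lemma norm_pos_square:
  assumes "star s = s"
  shows "norm_pos (s * s)"
  unfolding norm_pos_def
  using norm_diff_square_le[OF assms order_refl] assms
  by (intro conjI exI[of _ "norm (s * s)"]) (auto simp: star_mult)

lemma norm_pos_norm:
  assumes "norm_pos a"
  shows "norm (norm a *\<^sub>R 1 - a) \<le> norm a"
proof -
  obtain s where "norm_pos s" "s * s = a"
    using norm_pos_sqrt[OF assms] by blast
  then show ?thesis
    using norm_diff_square_le[of s "norm a"] by (simp add: norm_pos_star)
qed

lemma norm_pos_mult:
  assumes "norm_pos a" "norm_pos b" "a * b = b * a"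
  shows "norm_pos (a * b)"
proof -
  obtain s where s: "norm_pos s" "s * s = a" "\<And>y. y * a = a * y \<Longrightarrow> y * s = s * y"
    using norm_pos_sqrt[OF assms(1)] by blast
  obtain r where r: "norm_pos r" "r * r = b" "\<And>y. y * b = b * y \<Longrightarrow> y * r = r * y"
    using norm_pos_sqrt[OF assms(2)] by blast
  have "s * r = r * s"
    using r(3)[of s] s(3)[of b] assms(3) by simp
  then have "star (s * r) = s * r"
    using s(1) r(1) by (simp add: star_mult norm_pos_star)
  moreover have "(s * r) * (s * r) = s * (r * s) * r"
    by (simp add: mult.assoc)
  then have "(s * r) * (s * r) = a * b"
    by (simp add: mult.assoc r(2) flip: \<open>s * r = r * s\<close> s(2))
  ultimately show ?thesis
    using norm_pos_square[of "s * r"] by simp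
qed

text \<open>
  Put \<open>y = 2 h / \<kappa> - 1\<close>. Then \<open>1 + y\<close> and \<open>1 - y\<close> are commuting elements of the cone, so
  \<open>1 - y\<^sup>2 = z\<^sup>2\<close> for some \<open>z\<close> in the cone that commutes with \<open>y\<close>, and \<open>\<parallel>y\<parallel> \<le> 1\<close> follows.
\<close>

lemma norm_pos_le:
  assumes "norm_pos h" "norm_pos (\<kappa> *\<^sub>R 1 - h)" "\<kappa> > 0"
  shows "norm h \<le> \<kappa>"
proof -
  define y where "y = (2 / \<kappa>) *\<^sub>R h - 1"
  have y1: "1 + y = (2 / \<kappa>) *\<^sub>R h" and y2: "1 - y = (2 / \<kappa>) *\<^sub>R (\<kappa> *\<^sub>R 1 - h)"
    using \<open>\<kappa> > 0\<close> by (simp_all add: y_def algebra_simps scaleR_2[symmetric])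
  have "norm_pos ((1 + y) * (1 - y))"
    using assms unfolding y1 y2
    by (intro norm_pos_mult norm_pos_scaleR) (auto simp: algebra_simps)
  then obtain z where z: "norm_pos z" "z * z = (1 + y) * (1 - y)"
      "\<And>x. x * ((1 + y) * (1 - y)) = (1 + y) * (1 - y) * x \<Longrightarrow> x * z = z * x"
    using norm_pos_sqrt by blast
  have "norm y \<le> 1"
  proof (rule norm_le_1_if_squares_sum_to_1)
    show "star y = y"
      using assms by (simp add: y_def star_diff star_scaleR norm_pos_star)
    show "star z = z"
      using z(1) by (rule norm_pos_star)
    show "y * z = z * y"
      by (rule z(3)) (simp add: algebra_simps)
    show "y * y + z * z = 1"
      by (simp add: z(2) algebra_simps)
  qed
  have "h = (\<kappa> / 2) *\<^sub>R (1 + y)"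
    using \<open>\<kappa> > 0\<close> by (simp add: y1)
  then have "norm h = \<kappa> / 2 * norm (1 + y)"
    using \<open>\<kappa> > 0\<close> by simp
  also have "\<dots> \<le> \<kappa> / 2 * 2"
    using \<open>norm y \<le> 1\<close> norm_triangle_ineq[of 1 y] \<open>\<kappa> > 0\<close> by (intro mult_left_mono) auto
  finally show ?thesis by simp
qed

lemma norm_pos_norm_minus:
  assumes "star a = a" "norm a \<le> c"
  shows "norm_pos (c *\<^sub>R 1 - a)"
  unfolding norm_pos_def using assms norm_ge_zero[of a]
  by (intro conjI exI[of _ c]) (auto simp: star_diff star_scaleR simp del: norm_ge_zero)

text \<open>
  Assume \<open>c \<noteq> 0\<close> and normalise to \<open>\<parallel>d\<parallel> = 1\<close>. With \<open>p = d d\<^sup>*\<close> and \<open>q = - d\<^sup>* d\<close>, the element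
  \<open>p - q = d d\<^sup>* + d\<^sup>* d\<close> is half a sum of two squares, so \<open>p\<close> is in the cone as well. The
  intertwining relation \<open>(1 + p) d = d (1 - q)\<close> now bounds \<open>(1 + p)\<^sup>n p = d (1 - q)\<^sup>n d\<^sup>*\<close> in norm
  by \<open>1\<close> for every \<open>n\<close>, whereas it dominates \<open>n p\<^sup>2\<close>, which has norm \<open>n\<close>. This takes the place of
  the fact that \<open>d d\<^sup>*\<close> and \<open>d\<^sup>* d\<close> have the same non-zero spectrum.
\<close>

lemma eq_0_if_minus_star_mult_pos:
  fixes c :: "'a::cstar_algebra"
  assumes "norm_pos (- (star c * c))"
  shows "c = 0"
proof (rule ccontr)
  assume "c \<noteq> 0"
  define d where "d = (1 / norm c) *\<^sub>R c"
  define p q where "p = d * star d" and "q = - (star d * d)"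
  have nd: "norm d = 1"
    using \<open>c \<noteq> 0\<close> by (simp add: d_def)
  have "q = (1 / (norm c)\<^sup>2) *\<^sub>R (- (star c * c))"
    by (simp add: q_def d_def star_scaleR power2_eq_square)
  then have q: "norm_pos q"
    using norm_pos_scaleR[OF assms] by simp
  have "norm_pos p"
  proof -
    define x y where "x = d + star d" and "y = \<i> *\<^sub>C (d - star d)"
    have "star y = (- \<i>) *\<^sub>C (star d - d)"
      by (simp add: y_def star_scaleC star_diff star_star)
    also have "\<dots> = y"
      by (simp add: y_def scaleC_minus_left scaleC_diff_right)
    finally have "star y = y" .
    moreover have "star x = x"
      by (simp add: x_def star_add star_star add.commute)
    ultimately have "norm_pos (x * x + y * y)"
      by (intro norm_pos_add norm_pos_square)
    moreover have "y * y = - ((d - star d) * (d - star d))"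
      by (simp add: y_def mult_scaleC_left mult_scaleC_right scaleC_scaleC scaleC_minus_1)
    then have "x * x + y * y = 2 *\<^sub>R (p - q)"
      by (simp add: x_def p_def q_def algebra_simps scaleR_2)
    ultimately have "norm_pos (2 *\<^sub>R (p - q))" by simp
    from norm_pos_add[OF norm_pos_scaleR[OF this, of "1/2"] q] show ?thesis
      by simp
  qed
  have np: "norm p = 1"
    using cstar_identity[of "star d"] by (simp add: p_def star_star norm_star nd)
  have nq: "norm q = 1"
    using cstar_identity[of "d"] by (simp add: q_def nd)
  have "norm (1 - q) \<le> 1"
    using norm_pos_norm[OF q] nq by simp
  have inter: "(1 + p) ^ n * d = d * (1 - q) ^ n" for n
  proof (induction n)
    case (Suc n)
    have "(1 + p) ^ Suc n * d = (1 + p) * ((1 + p) ^ n * d)"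
      by (simp add: mult.assoc)
    also have "\<dots> = ((1 + p) * d) * (1 - q) ^ n"
      by (simp add: Suc mult.assoc)
    also have "(1 + p) * d = d * (1 - q)"
      by (simp add: p_def q_def algebra_simps)
    finally show ?case by (simp add: mult.assoc)
  qed simp
  have up: "norm ((1 + p) ^ n * p) \<le> 1" for n
  proof -
    have "norm ((1 - q) ^ n) \<le> 1"
      using norm_power_ineq[of "1 - q" n] power_le_one[of "norm (1 - q)" n] \<open>norm (1 - q) \<le> 1\<close>
      by simp
    have "(1 + p) ^ n * p = d * (1 - q) ^ n * star d"
      by (simp add: p_def mult.assoc flip: inter)
    also have "norm \<dots> \<le> norm (d * (1 - q) ^ n) * norm (star d)"
      by (rule norm_mult_ineq)
    also have "\<dots> \<le> norm d * norm ((1 - q) ^ n)"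
      using norm_mult_ineq[of d "(1 - q) ^ n"] by (simp add: norm_star nd)
    also have "\<dots> \<le> 1"
      using \<open>norm ((1 - q) ^ n) \<le> 1\<close> by (simp add: nd)
    finally show ?thesis .
  qed
  have pp: "norm_pos (p * p)" "norm_pos (1 + p)" "norm_pos (p * p * p)"
    using \<open>norm_pos p\<close> norm_pos_square[of 1] by (auto intro!: norm_pos_mult norm_pos_add simp: mult.assoc)
  \<comment> \<open>The term \<open>p\<close> is subtracted as well so that the induction closes.\<close>
  have low: "norm_pos ((1 + p) ^ n * p - p - real n *\<^sub>R (p * p))" (is "norm_pos (?r n)") for n
  proof (induction n)
    case 0
    then show ?case using norm_pos_square[of 0] by simp
  next
    case (Suc n)
    have comm: "(1 + p) ^ n * p = p * (1 + p) ^ n"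
      by (rule power_commuting_commutes) (simp add: algebra_simps)
    have "?r (Suc n) = (1 + p) * ?r n + real n *\<^sub>R (p * p * p)"
      by (simp add: algebra_simps)
    moreover have "(1 + p) * ?r n = ?r n * (1 + p)"
      by (simp add: algebra_simps comm)
    ultimately show ?case
      using pp Suc by (simp add: norm_pos_add norm_pos_mult norm_pos_scaleR)
  qed
  have "real n \<le> 1" for n
  proof -
    let ?h = "real n *\<^sub>R (p * p)"
    have sp: "star p = p"
      using \<open>norm_pos p\<close> by (rule norm_pos_star)
    have "(1 + p) ^ n * p = p * (1 + p) ^ n"
      by (rule power_commuting_commutes) (simp add: algebra_simps)
    then have "star ((1 + p) ^ n * p) = (1 + p) ^ n * p"
      by (simp add: star_mult star_power star_add sp)
    then have "norm_pos (1 *\<^sub>R 1 - (1 + p) ^ n * p)"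
      using up by (intro norm_pos_norm_minus)
    from norm_pos_add[OF this norm_pos_add[OF low[of n] \<open>norm_pos p\<close>]]
    have "norm_pos (1 *\<^sub>R 1 - ?h)" by (simp add: algebra_simps)
    then have "norm ?h \<le> 1"
      using pp by (intro norm_pos_le norm_pos_scaleR) auto
    moreover have "norm (p * p) = 1"
      using cstar_identity[of p] by (simp add: sp np)
    ultimately show ?thesis by simp
  qed
  from this[of 2] show False by simp
qed

text \<open>
  Kaplansky's argument. Let \<open>h = b\<^sup>* b\<close>, let \<open>m = \<bar>h\<bar>\<close> be the root of \<open>h\<^sup>2\<close>, and let \<open>k = m - h\<close> be
  twice the negative part of \<open>h\<close>. Then \<open>(b k)\<^sup>* (b k) = k h k = - k m k\<close> is minus a square, so
  \<open>b k = 0\<close> by the previous lemma. This forces \<open>k = 0\<close>, that is, \<open>h = \<bar>h\<bar>\<close>.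
\<close>

lemma norm_pos_star_mult: "norm_pos (star b * b)"
proof -
  define h where "h = star b * b"
  have sh: "star h = h"
    by (simp add: h_def star_mult star_star)
  obtain m where m: "norm_pos m" "m * m = h * h" "\<And>y. y * (h * h) = (h * h) * y \<Longrightarrow> y * m = m * y"
    using norm_pos_sqrt[OF norm_pos_square[OF sh]] by blast
  obtain r where r: "norm_pos r" "r * r = m" "\<And>y. y * m = m * y \<Longrightarrow> y * r = r * y"
    using norm_pos_sqrt[OF m(1)] by blast
  define k where "k = m - h"
  have hm: "h * m = m * h"
    by (rule m(3)) (simp add: mult.assoc)
  then have km: "k * m = m * k" "k * h = h * k"
    by (simp_all add: k_def algebra_simps)
  have kr: "k * r = r * k"
    using km by (intro r(3))
  have sk: "star k = k" "star r = r"
    using r(1) m(1) by (simp_all add: k_def star_diff sh norm_pos_star)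
  have hk: "h * k = - (m * k)"
    by (simp add: k_def algebra_simps m(2) hm)
  have "star (b * k) * (b * k) = k * h * k"
    by (simp add: star_mult sk h_def mult.assoc)
  also have "\<dots> = - (k * m * k)"
    by (simp add: mult.assoc hk)
  also have "k * m * k = (k * r) * (k * r)"
  proof -
    have "(k * r) * (k * r) = k * (r * k) * r"
      by (simp add: mult.assoc)
    also have "\<dots> = k * k * m"
      by (simp add: mult.assoc r(2) flip: kr)
    finally show ?thesis
      by (simp add: mult.assoc flip: km(1))
  qed
  finally have eq: "- (star (b * k) * (b * k)) = (k * r) * (k * r)" by simp
  have sq0: "x = 0" if "star x = x" "x * x = 0" for x :: 'a
    using cstar_identity[of x] that by simp
  have skr: "star (k * r) = k * r"
    by (simp add: star_mult sk kr)
  then have "b * k = 0"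
    using norm_pos_square[of "k * r"] eq by (intro eq_0_if_minus_star_mult_pos) simp
  with eq have "k * r = 0"
    using sq0[OF skr] by simp
  moreover have "m * k = r * (r * k)"
    by (simp add: mult.assoc flip: r(2))
  ultimately have "m * k = 0"
    by (simp flip: kr)
  moreover have "k * k = m * k - h * k"
    by (simp add: k_def algebra_simps)
  ultimately have "k * k = 0"
    by (simp add: hk)
  then have "k = 0"
    by (rule sq0[OF sk(1)])
  then show ?thesis
    using m(1) by (simp add: k_def h_def)
qed

lemma cstar_pos_iff_norm_pos: "cstar_pos a \<longleftrightarrow> norm_pos a"
proof
  assume "norm_pos a"
  then obtain s where "norm_pos s" "s * s = a"
    using norm_pos_sqrt by blast
  then have "a = star s * s"
    by (simp add: norm_pos_star)
  then show "cstar_pos a"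
    unfolding cstar_pos_def ..
qed (auto simp: cstar_pos_def norm_pos_star_mult)

lemma cstar_pos_star_mult [intro]: "cstar_pos (star b * b)"
  by (auto simp: cstar_pos_def)

lemma cstar_pos_star: "cstar_pos a \<Longrightarrow> star a = a"
  by (simp add: cstar_pos_iff_norm_pos norm_pos_star)

lemma cstar_pos_0 [simp]: "cstar_pos 0"
  using cstar_pos_star_mult[of 0] by simp

lemma cstar_pos_add: "cstar_pos a \<Longrightarrow> cstar_pos b \<Longrightarrow> cstar_pos (a + b)"
  by (simp add: cstar_pos_iff_norm_pos norm_pos_add)

lemma cstar_pos_sum: "(\<And>i. i \<in> I \<Longrightarrow> cstar_pos (f i)) \<Longrightarrow> cstar_pos (sum f I)"
  by (induction I rule: infinite_finite_induct) (auto intro: cstar_pos_add)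

lemma cstar_pos_scaleR: "cstar_pos a \<Longrightarrow> r \<ge> 0 \<Longrightarrow> cstar_pos (r *\<^sub>R a)"
  by (simp add: cstar_pos_iff_norm_pos norm_pos_scaleR)

lemma cstar_pos_conj:
  assumes "cstar_pos a"
  shows "cstar_pos (star x * a * x)"
proof -
  obtain b where "a = star b * b"
    using assms by (auto simp: cstar_pos_def)
  then have "star x * a * x = star (b * x) * (b * x)"
    by (simp add: star_mult mult.assoc)
  then show ?thesis by auto
qed

lemma cstar_pos_norm_minus:
  assumes "norm a \<le> c"
  shows "cstar_pos (c\<^sup>2 *\<^sub>R 1 - star a * a)"
  unfolding cstar_pos_iff_norm_pos
  using assms by (intro norm_pos_norm_minus) (auto simp: star_mult star_star cstar_identity power_mono)

lemma norm_le_if_cstar_pos: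
  assumes "cstar_pos (c\<^sup>2 *\<^sub>R 1 - star a * a)" "c > 0"
  shows "norm a \<le> c"
proof -
  have "norm (star a * a) \<le> c\<^sup>2"
    using assms norm_pos_star_mult[of a] by (intro norm_pos_le) (auto simp: cstar_pos_iff_norm_pos)
  then show ?thesis
    using assms(2) by (simp add: cstar_identity)
qed

text \<open>
  Closedness: for elements of the cone, the condition \<open>\<parallel>c - a\<parallel> \<le> c\<close> may be taken at
  \<open>c = \<parallel>a\<parallel>\<close>, and both sides are continuous in \<open>a\<close>.
\<close>

lemma cstar_pos_limit:
  assumes "(f \<longlongrightarrow> a) F" "F \<noteq> bot" "\<forall>\<^sub>F t in F. cstar_pos (f t)"
  shows "cstar_pos a"
proof -
  have "((\<lambda>t. star (f t)) \<longlongrightarrow> star a) F"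
    using bounded_linear.tendsto[OF bounded_linear_star assms(1)] .
  moreover have "((\<lambda>t. star (f t)) \<longlongrightarrow> a) F"
    by (rule Lim_transform_eventually[OF assms(1)])
      (use assms(3) in \<open>auto elim!: eventually_mono simp: cstar_pos_star\<close>)
  ultimately have "star a = a"
    using tendsto_unique[OF assms(2)] by blast
  moreover have "norm (norm a *\<^sub>R 1 - a) \<le> norm a"
  proof (rule tendsto_le[OF assms(2)])
    show "((\<lambda>t. norm (f t)) \<longlongrightarrow> norm a) F"
      by (intro tendsto_intros assms)
    show "((\<lambda>t. norm (norm (f t) *\<^sub>R 1 - f t)) \<longlongrightarrow> norm (norm a *\<^sub>R 1 - a)) F"
      by (intro tendsto_intros assms)
    show "\<forall>\<^sub>F t in F. norm (norm (f t) *\<^sub>R 1 - f t) \<le> norm (f t)"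
      using assms(3) by (auto elim!: eventually_mono simp: cstar_pos_iff_norm_pos norm_pos_norm)
  qed
  ultimately show ?thesis
    unfolding cstar_pos_iff_norm_pos norm_pos_def
    by (intro conjI exI[of _ "norm a"]) simp_all
qed

section \<open>Square roots of positive kernels\<close>

text \<open>
  Matrices are functions of two indices, of which those below \<open>n\<close> matter; this allows \<open>n\<close> to grow
  and indices to be dropped without changing types.
\<close>

definition herm_kernel :: "nat \<Rightarrow> (nat \<Rightarrow> nat \<Rightarrow> 'a::cstar_algebra) \<Rightarrow> bool" where
  "herm_kernel n M \<longleftrightarrow> (\<forall>i<n. \<forall>j<n. star (M i j) = M j i)"

definition kernel_form :: "nat \<Rightarrow> (nat \<Rightarrow> nat \<Rightarrow> 'a::cstar_algebra) \<Rightarrow> (nat \<Rightarrow> 'a) \<Rightarrow> 'a" where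
  "kernel_form n M x = (\<Sum>i<n. \<Sum>j<n. star (x i) * M i j * x j)"

definition pos_kernel :: "nat \<Rightarrow> (nat \<Rightarrow> nat \<Rightarrow> 'a::cstar_algebra) \<Rightarrow> bool" where
  "pos_kernel n M \<longleftrightarrow> herm_kernel n M \<and> (\<forall>x. cstar_pos (kernel_form n M x))"

definition cinner :: "nat \<Rightarrow> (nat \<Rightarrow> 'a::cstar_algebra) \<Rightarrow> (nat \<Rightarrow> 'a) \<Rightarrow> 'a" where
  "cinner n x y = (\<Sum>i<n. star (x i) * y i)"

definition kernel_apply :: "nat \<Rightarrow> (nat \<Rightarrow> nat \<Rightarrow> 'a::cstar_algebra) \<Rightarrow> (nat \<Rightarrow> 'a) \<Rightarrow> nat \<Rightarrow> 'a" where
  "kernel_apply n M x = (\<lambda>i. \<Sum>j<n. M i j * x j)"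

definition unit_fun :: "nat \<Rightarrow> nat \<Rightarrow> 'a::cstar_algebra" where
  "unit_fun j = (\<lambda>i. if i = j then 1 else 0)"

lemma kernel_form_eq_cinner: "kernel_form n M x = cinner n x (kernel_apply n M x)"
  by (simp add: kernel_form_def cinner_def kernel_apply_def sum_distrib_left mult.assoc)

lemma cinner_simps:
  "cinner n (\<lambda>i. x i + y i) z = cinner n x z + cinner n y z"
  "cinner n (\<lambda>i. x i - y i) z = cinner n x z - cinner n y z"
  "cinner n z (\<lambda>i. x i + y i) = cinner n z x + cinner n z y"
  "cinner n z (\<lambda>i. x i - y i) = cinner n z x - cinner n z y"
  by (simp_all add: cinner_def star_add star_diff algebra_simps sum.distrib sum_subtractf)

lemma star_cinner: "star (cinner n x y) = cinner n y x"
  by (simp add: cinner_def star_sum star_mult star_star)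

lemma cinner_self_pos: "cstar_pos (cinner n x x)"
  unfolding cinner_def by (intro cstar_pos_sum) auto

lemma cinner_unit_fun: "i < n \<Longrightarrow> cinner n (unit_fun i) w = w i"
  unfolding cinner_def unit_fun_def
  by (subst sum.cong[OF refl, where h = "\<lambda>l. if l = i then w l else 0"]) auto

lemma kernel_apply_simps:
  "kernel_apply n M (\<lambda>i. x i + y i) = (\<lambda>i. kernel_apply n M x i + kernel_apply n M y i)"
  "kernel_apply n M (\<lambda>i. x i - y i) = (\<lambda>i. kernel_apply n M x i - kernel_apply n M y i)"
  by (simp_all add: kernel_apply_def algebra_simps sum.distrib sum_subtractf fun_eq_iff)

lemma cinner_kernel_apply:
  assumes "herm_kernel n M"
  shows "cinner n (kernel_apply n M x) y = cinner n x (kernel_apply n M y)"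
proof -
  have "cinner n (kernel_apply n M x) y = (\<Sum>i<n. \<Sum>j<n. star (x j) * star (M i j) * y i)"
    by (simp add: cinner_def kernel_apply_def star_sum star_mult sum_distrib_right)
  also have "\<dots> = (\<Sum>i<n. \<Sum>j<n. star (x j) * M j i * y i)"
    using assms by (intro sum.cong refl) (simp add: herm_kernel_def)
  also have "\<dots> = (\<Sum>j<n. \<Sum>i<n. star (x j) * M j i * y i)"
    by (rule sum.swap)
  also have "\<dots> = cinner n x (kernel_apply n M y)"
    by (simp add: cinner_def kernel_apply_def sum_distrib_left mult.assoc)
  finally show ?thesis .
qed

lemma cinner_kernel_apply_power:
  assumes "herm_kernel n M"
  shows "cinner n ((kernel_apply n M ^^ k) x) y = cinner n x ((kernel_apply n M ^^ k) y)"
proof (induction k arbitrary: y)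
  case (Suc k)
  then show ?case
    by (simp add: cinner_kernel_apply[OF assms] flip: funpow_swap1)
qed simp

text \<open>
  This says \<open>- 1 \<le> X \<le> 1\<close> in the sense of the \<open>A\<close>-valued quadratic forms on \<open>A\<^sup>n\<close>.
\<close>

definition contractive_kernel :: "nat \<Rightarrow> (nat \<Rightarrow> nat \<Rightarrow> 'a::cstar_algebra) \<Rightarrow> bool" where
  "contractive_kernel n X \<longleftrightarrow> herm_kernel n X \<and>
    (\<forall>v. cstar_pos (cinner n v v - cinner n v (kernel_apply n X v)) \<and>
         cstar_pos (cinner n v v + cinner n v (kernel_apply n X v)))"

text \<open>
  The operator identity \<open>2 (1 - X\<^sup>2) = (1 - X) (1 + X) (1 - X) + (1 + X) (1 - X) (1 + X)\<close> shows
  that \<open>X\<close> does not increase the \<open>A\<close>-valued inner square of a vector. Thus the powers of \<open>X\<close> are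
  bounded entrywise although \<open>M\<^sub>n(A)\<close> carries no norm here.
\<close>

lemma contractive_kernel_apply:
  assumes "contractive_kernel n X"
  shows "cstar_pos (cinner n v v - cinner n (kernel_apply n X v) (kernel_apply n X v))"
proof -
  define y where "y = kernel_apply n X v"
  define z where "z = kernel_apply n X y"
  have herm: "herm_kernel n X"
    using assms by (simp add: contractive_kernel_def)
  have vz: "cinner n v z = cinner n y y"
    by (simp add: y_def z_def cinner_kernel_apply[OF herm])
  let ?u = "\<lambda>i. v i - y i" and ?w = "\<lambda>i. v i + y i"
  have "cstar_pos ((1/2) *\<^sub>R ((cinner n ?u ?u + cinner n ?u (kernel_apply n X ?u)) +
      (cinner n ?w ?w - cinner n ?w (kernel_apply n X ?w))))"
    using assms unfolding contractive_kernel_def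
    by (intro cstar_pos_scaleR cstar_pos_add[of "_ + _" "_ - _"]) auto
  also have "(cinner n ?u ?u + cinner n ?u (kernel_apply n X ?u)) +
      (cinner n ?w ?w - cinner n ?w (kernel_apply n X ?w)) = 2 *\<^sub>R (cinner n v v - cinner n y y)"
    by (simp add: kernel_apply_simps cinner_simps vz scaleR_2 flip: y_def z_def)
  finally show ?thesis
    by (simp add: y_def)
qed

lemma contractive_kernel_power:
  assumes "contractive_kernel n X"
  shows "cstar_pos (cinner n v v -
    cinner n ((kernel_apply n X ^^ k) v) ((kernel_apply n X ^^ k) v))"
proof (induction k)
  case (Suc k)
  from cstar_pos_add[OF Suc contractive_kernel_apply[OF assms, of "(kernel_apply n X ^^ k) v"]] show ?case
    by simp
qed simp

definition kernel_power :: "nat \<Rightarrow> (nat \<Rightarrow> nat \<Rightarrow> 'a::cstar_algebra) \<Rightarrow> nat \<Rightarrow> nat \<Rightarrow> nat \<Rightarrow> 'a" where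
  "kernel_power n X k i j = (kernel_apply n X ^^ k) (unit_fun j) i"

lemma kernel_power_0: "kernel_power n X 0 i j = (if i = j then 1 else 0)"
  by (simp add: kernel_power_def unit_fun_def)

lemma kernel_power_1: "j < n \<Longrightarrow> kernel_power n X 1 i j = X i j"
  unfolding kernel_power_def unit_fun_def
  by (simp add: kernel_apply_def if_distrib[of "\<lambda>x. _ * x"] cong: if_cong)

text \<open>
  The entries of \<open>kernel_power\<close> are defined as the images of the unit vectors; this is the expansion
  of an arbitrary vector in unit vectors.
\<close>

lemma kernel_apply_power_eq:
  assumes "i < n"
  shows "(kernel_apply n X ^^ k) w i = (\<Sum>l<n. kernel_power n X k i l * w l)"
  using assms
proof (induction k arbitrary: i)
  case 0
  then show ?case
    by (simp add: kernel_power_0 if_distrib[of "\<lambda>x. x * _"] cong: if_cong)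
next
  case (Suc k)
  have "(kernel_apply n X ^^ Suc k) w i = (\<Sum>j<n. \<Sum>l<n. X i j * (kernel_power n X k j l * w l))"
    by (simp add: kernel_apply_def Suc.IH sum_distrib_left)
  also have "\<dots> = (\<Sum>l<n. \<Sum>j<n. X i j * (kernel_power n X k j l * w l))"
    by (rule sum.swap)
  also have "\<dots> = (\<Sum>l<n. kernel_power n X (Suc k) i l * w l)"
    by (simp add: kernel_power_def kernel_apply_def sum_distrib_right mult.assoc)
  finally show ?case .
qed

lemma kernel_power_add:
  assumes "i < n"
  shows "(\<Sum>l<n. kernel_power n X m i l * kernel_power n X k l j) = kernel_power n X (m + k) i j"
  using kernel_apply_power_eq[OF assms, where w = "(kernel_apply n X ^^ k) (unit_fun j)" and k = m]
  by (simp add: kernel_power_def funpow_add)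

lemma star_kernel_power:
  assumes "herm_kernel n X" "i < n" "j < n"
  shows "star (kernel_power n X k i j) = kernel_power n X k j i"
proof -
  have "kernel_power n X k i j = cinner n (unit_fun i) ((kernel_apply n X ^^ k) (unit_fun j))"
    using assms by (simp add: kernel_power_def cinner_unit_fun)
  also have "\<dots> = cinner n ((kernel_apply n X ^^ k) (unit_fun i)) (unit_fun j)"
    by (simp add: cinner_kernel_apply_power[OF assms(1)])
  also have "star \<dots> = kernel_power n X k j i"
    using assms by (simp add: star_cinner cinner_unit_fun kernel_power_def)
  finally show ?thesis .
qed

lemma kernel_power_commute:
  assumes "\<And>i j. i < n \<Longrightarrow> j < n \<Longrightarrow> y * X i j = X i j * y" "i < n"
  shows "y * kernel_power n X k i j = kernel_power n X k i j * y"
  using assms(2)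
proof (induction k arbitrary: i)
  case (Suc k)
  have *: "kernel_power n X (Suc k) i j = (\<Sum>l<n. X i l * kernel_power n X k l j)"
    by (simp add: kernel_power_def kernel_apply_def)
  have "y * (X i l * kernel_power n X k l j) = X i l * kernel_power n X k l j * y" if "l < n" for l
    using assms(1)[OF \<open>i < n\<close> that] Suc.IH[OF that] by (metis mult.assoc)
  then show ?case
    by (simp add: * sum_distrib_left sum_distrib_right)
qed (simp add: kernel_power_0)

text \<open>
  Column \<open>j\<close> of the \<open>k\<close>-th power is the image of a unit vector, so its inner square is at most \<open>1\<close>,
  and a fortiori so is \<open>a\<^sup>* a\<close> for each of its entries \<open>a\<close>.
\<close>

lemma norm_kernel_power_le:
  assumes "contractive_kernel n X" "i < n" "j < n"
  shows "norm (kernel_power n X k i j) \<le> 1"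
proof (rule norm_le_if_cstar_pos)
  let ?w = "(kernel_apply n X ^^ k) (unit_fun j)"
  have "cinner n ?w ?w = star (?w i) * ?w i + (\<Sum>l\<in>{..<n}-{i}. star (?w l) * ?w l)"
    using assms(2) by (simp add: cinner_def sum.remove[of _ i])
  moreover have "cinner n (unit_fun j) (unit_fun j) = (1::'a)"
    using assms(3) by (simp add: cinner_unit_fun) (simp add: unit_fun_def)
  moreover have "cstar_pos (\<Sum>l\<in>{..<n}-{i}. star (?w l) * ?w l)"
    by (intro cstar_pos_sum) auto
  ultimately show "cstar_pos (1\<^sup>2 *\<^sub>R 1 - star (kernel_power n X k i j) * kernel_power n X k i j)"
    using cstar_pos_add[OF contractive_kernel_power[OF assms(1), of "unit_fun j" k]]
    by (fastforce simp: kernel_power_def)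
qed simp

text \<open>
  The binomial series is summed entrywise. Commutation with the entries is recorded because it makes
  the root of a matrix with central entries have central entries.
\<close>

lemma sqrt_one_minus_kernel:
  fixes X :: "nat \<Rightarrow> nat \<Rightarrow> 'a::cstar_algebra"
  assumes "contractive_kernel n X"
  shows "\<exists>S. herm_kernel n S \<and>
    (\<forall>i<n. \<forall>j<n. (\<Sum>l<n. S i l * S l j) = (if i = j then 1 else 0) - X i j) \<and>
    (\<forall>y. (\<forall>i<n. \<forall>j<n. y * X i j = X i j * y) \<longrightarrow> (\<forall>i<n. \<forall>j<n. y * S i j = S i j * y))"
proof (intro exI conjI allI impI)
  let ?S = "\<lambda>i j. \<Sum>k. sqrt_coeff k *\<^sub>R kernel_power n X k i j"
  have summ: "summable (\<lambda>k. sqrt_coeff k *\<^sub>R kernel_power n X k i j)" if "i < n" "j < n" for i j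
    using norm_kernel_power_le[OF assms that] by (rule summable_sqrt_series)
  have herm: "herm_kernel n X"
    using assms by (simp add: contractive_kernel_def)
  show "herm_kernel n ?S"
    unfolding herm_kernel_def
    by (auto simp: bounded_linear.suminf[OF bounded_linear_star summ] star_scaleR
        star_kernel_power[OF herm])
  fix i j assume ij: "i < n" "j < n"
  have "(\<lambda>k. \<Sum>l<n. \<Sum>m\<le>k. (sqrt_coeff m * sqrt_coeff (k - m)) *\<^sub>R
      (kernel_power n X m i l * kernel_power n X (k - m) l j)) sums (\<Sum>l<n. ?S i l * ?S l j)"
    using norm_kernel_power_le[OF assms] ij
    by (intro sums_sum sqrt_series_mult) auto
  also have "(\<lambda>k. \<Sum>l<n. \<Sum>m\<le>k. (sqrt_coeff m * sqrt_coeff (k - m)) *\<^sub>R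
      (kernel_power n X m i l * kernel_power n X (k - m) l j)) =
    (\<lambda>k. \<Sum>m\<le>k. (sqrt_coeff m * sqrt_coeff (k - m)) *\<^sub>R kernel_power n X k i j)"
    by (subst sum.swap) (simp add: kernel_power_add[OF ij(1)] flip: scaleR_sum_right)
  finally have "(\<Sum>l<n. ?S i l * ?S l j) = kernel_power n X 0 i j - kernel_power n X 1 i j"
    by (rule sums_unique2[OF _ sqrt_series_square_sums])
  then show "(\<Sum>l<n. ?S i l * ?S l j) = (if i = j then 1 else 0) - X i j"
    using ij by (simp only: kernel_power_0 kernel_power_1)
next
  fix y i j
  assume y: "\<forall>i<n. \<forall>j<n. y * X i j = X i j * y" and ij: "i < n" "j < n"
  have summ: "summable (\<lambda>k. sqrt_coeff k *\<^sub>R kernel_power n X k i j)"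
    using norm_kernel_power_le[OF assms ij] by (rule summable_sqrt_series)
  have "y * kernel_power n X k i j = kernel_power n X k i j * y" for k
    using y ij by (intro kernel_power_commute) auto
  then show "y * (\<Sum>k. sqrt_coeff k *\<^sub>R kernel_power n X k i j) =
      (\<Sum>k. sqrt_coeff k *\<^sub>R kernel_power n X k i j) * y"
    by (simp add: suminf_mult2[OF summ] flip: suminf_mult[OF summ])
qed

text \<open>
  Let \<open>C\<close> bound the norms of the entries. Then \<open>(x\<^sub>i - M\<^sub>i\<^sub>j x\<^sub>j)\<^sup>* (x\<^sub>i - M\<^sub>i\<^sub>j x\<^sub>j)\<close> and
  \<open>x\<^sub>j\<^sup>* (C\<^sup>2 - M\<^sub>i\<^sub>j\<^sup>* M\<^sub>i\<^sub>j) x\<^sub>j\<close> are positive. Their sum over all \<open>i, j\<close> is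
  \<open>n (1 + C\<^sup>2) \<langle>x, x\<rangle> - 2 \<langle>x, M x\<rangle>\<close>.
\<close>

lemma kernel_form_upper_bound:
  assumes "herm_kernel n M"
  shows "\<exists>c>0. \<forall>x. cstar_pos (c *\<^sub>R cinner n x x - kernel_form n M x)"
proof -
  define C where "C = (\<Sum>i<n. \<Sum>j<n. norm (M i j))"
  \<comment> \<open>The summand \<open>1\<close> makes \<open>c\<close> positive also for \<open>n = 0\<close>.\<close>
  define c where "c = real n * (1 + C\<^sup>2) / 2 + 1"
  have C: "norm (M i j) \<le> C" if "i < n" "j < n" for i j
  proof -
    have "norm (M i j) \<le> (\<Sum>j<n. norm (M i j))"
      using that by (intro member_le_sum) auto
    also have "\<dots> \<le> C"
      unfolding C_def using that by (intro member_le_sum[of i] sum_nonneg) auto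
    finally show ?thesis .
  qed
  have "c > 0"
    by (simp add: c_def add_nonneg_pos)
  moreover have "cstar_pos (c *\<^sub>R cinner n x x - kernel_form n M x)" for x
  proof -
    let ?d = "\<lambda>i j. x i - M i j * x j"
    let ?e = "\<lambda>i j. star (x j) * (C\<^sup>2 *\<^sub>R 1 - star (M i j) * M i j) * x j"
    have swap: "(\<Sum>i<n. \<Sum>j<n. star (x j) * star (M i j) * x i) = kernel_form n M x"
    proof -
      have "(\<Sum>i<n. \<Sum>j<n. star (x j) * star (M i j) * x i) = (\<Sum>i<n. \<Sum>j<n. star (x j) * M j i * x i)"
        using assms by (intro sum.cong refl) (simp add: herm_kernel_def)
      also have "\<dots> = kernel_form n M x"
        unfolding kernel_form_def by (rule sum.swap)
      finally show ?thesis .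
    qed
    have pos: "cstar_pos (\<Sum>i<n. \<Sum>j<n. star (?d i j) * ?d i j + ?e i j)"
      by (intro cstar_pos_sum cstar_pos_add cstar_pos_conj cstar_pos_norm_minus C) auto
    have split: "star (?d i j) * ?d i j + ?e i j = star (x i) * x i + C\<^sup>2 *\<^sub>R (star (x j) * x j)
        - star (x i) * M i j * x j - star (x j) * star (M i j) * x i" for i j
      by (simp add: star_diff star_mult algebra_simps)
    have "(\<Sum>i<n. \<Sum>j<n. star (?d i j) * ?d i j + ?e i j) =
        (\<Sum>i<n. \<Sum>j<n. star (x i) * x i) + C\<^sup>2 *\<^sub>R (\<Sum>i<n. \<Sum>j<n. star (x j) * x j)
        - kernel_form n M x - kernel_form n M x"
      unfolding split sum.distrib sum_subtractf swap
      by (simp only: kernel_form_def scaleR_sum_right)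
    also have "\<dots> = (real n * (1 + C\<^sup>2)) *\<^sub>R cinner n x x - 2 *\<^sub>R kernel_form n M x"
      by (simp add: cinner_def algebra_simps sum_constant_scaleR scaleR_2 del: sum_constant
          flip: scaleR_sum_right)
    finally have "cstar_pos ((real n * (1 + C\<^sup>2)) *\<^sub>R cinner n x x - 2 *\<^sub>R kernel_form n M x)"
      using pos by simp
    from cstar_pos_add[OF cstar_pos_scaleR[OF this, of "1/2"] cinner_self_pos[of n x]]
    show ?thesis
      by (simp add: c_def algebra_simps add_divide_distrib)
  qed
  ultimately show ?thesis by blast
qed

text \<open>
  If \<open>M \<le> c\<close>, then \<open>0 \<le> M \<le> c\<close> makes \<open>X = 1 - M / c\<close> contractive, and \<open>M = c (1 - X)\<close>.
\<close>

lemma pos_kernel_sqrt: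
  fixes M :: "nat \<Rightarrow> nat \<Rightarrow> 'a::cstar_algebra"
  assumes "pos_kernel n M"
  shows "\<exists>S. herm_kernel n S \<and>
    (\<forall>i<n. \<forall>j<n. (\<Sum>l<n. S i l * S l j) = M i j) \<and>
    (\<forall>y. (\<forall>i<n. \<forall>j<n. y * M i j = M i j * y) \<longrightarrow> (\<forall>i<n. \<forall>j<n. y * S i j = S i j * y))"
proof -
  have herm: "herm_kernel n M" and pos: "\<And>x. cstar_pos (kernel_form n M x)"
    using assms by (auto simp: pos_kernel_def)
  obtain c where c: "c > 0" "\<And>x. cstar_pos (c *\<^sub>R cinner n x x - kernel_form n M x)"
    using kernel_form_upper_bound[OF herm] by blast
  define X where "X i j = (if i = j then 1 else 0) - (1/c) *\<^sub>R M i j" for i j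
  have form: "cinner n v (kernel_apply n X v) = cinner n v v - (1/c) *\<^sub>R kernel_form n M v" for v
  proof -
    have "kernel_apply n X v i = v i - (1/c) *\<^sub>R kernel_apply n M v i" if "i < n" for i
      using that by (simp add: kernel_apply_def X_def left_diff_distrib sum_subtractf
          if_distrib[of "\<lambda>x. x * _"] scaleR_sum_right cong: if_cong)
    then have "cinner n v (kernel_apply n X v) = cinner n v (\<lambda>i. v i - (1/c) *\<^sub>R kernel_apply n M v i)"
      by (simp add: cinner_def)
    then show ?thesis
      by (simp add: cinner_simps kernel_form_eq_cinner) (simp add: cinner_def scaleR_sum_right)
  qed
  have "contractive_kernel n X"
    unfolding contractive_kernel_def
  proof (intro conjI allI)
    show "herm_kernel n X"
      using herm by (auto simp: herm_kernel_def X_def star_diff star_scaleR star_minus)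
    fix v
    show "cstar_pos (cinner n v v - cinner n v (kernel_apply n X v))"
      using cstar_pos_scaleR[OF pos, of "1/c" v] c(1) by (simp add: form)
    have "cstar_pos (cinner n v v + (1/c) *\<^sub>R (c *\<^sub>R cinner n v v - kernel_form n M v))"
      using c by (intro cstar_pos_add cstar_pos_scaleR cinner_self_pos) auto
    then show "cstar_pos (cinner n v v + cinner n v (kernel_apply n X v))"
      using c(1) by (simp add: form algebra_simps)
  qed
  then obtain T where T: "herm_kernel n T"
    "\<forall>i<n. \<forall>j<n. (\<Sum>l<n. T i l * T l j) = (if i = j then 1 else 0) - X i j"
    "\<forall>y. (\<forall>i<n. \<forall>j<n. y * X i j = X i j * y) \<longrightarrow> (\<forall>i<n. \<forall>j<n. y * T i j = T i j * y)"
    using sqrt_one_minus_kernel by blast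
  show ?thesis
  proof (intro exI[of _ "\<lambda>i j. sqrt c *\<^sub>R T i j"] conjI allI impI)
    show "herm_kernel n (\<lambda>i j. sqrt c *\<^sub>R T i j)"
      using T(1) by (auto simp: herm_kernel_def star_scaleR)
    fix i j assume ij: "i < n" "j < n"
    show "(\<Sum>l<n. (sqrt c *\<^sub>R T i l) * (sqrt c *\<^sub>R T l j)) = M i j"
      using c(1) by (simp add: T(2) ij X_def flip: scaleR_sum_right)
  next
    fix y i j
    assume y: "\<forall>i<n. \<forall>j<n. y * M i j = M i j * y" and ij: "i < n" "j < n"
    have "y * X i j = X i j * y" if "i < n" "j < n" for i j
      using y that by (simp add: X_def algebra_simps)
    from T(3)[rule_format, OF this] ij show "y * (sqrt c *\<^sub>R T i j) = (sqrt c *\<^sub>R T i j) * y"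
      by simp
  qed
qed

lemma pos_kernel_gram:
  assumes "\<And>i j. i < n \<Longrightarrow> j < n \<Longrightarrow> M i j = (\<Sum>k<m. star (B k i) * B k j)"
  shows "pos_kernel n M"
  unfolding pos_kernel_def
proof (intro conjI allI)
  show "herm_kernel n M"
    by (simp add: herm_kernel_def assms star_sum star_mult star_star)
  fix x
  have "kernel_form n M x = (\<Sum>i<n. \<Sum>j<n. \<Sum>k<m. star (B k i * x i) * (B k j * x j))"
    by (simp add: kernel_form_def assms sum_distrib_left sum_distrib_right star_mult mult.assoc)
  also have "\<dots> = (\<Sum>i<n. \<Sum>k<m. \<Sum>j<n. star (B k i * x i) * (B k j * x j))"
    by (intro sum.cong refl sum.swap)
  also have "\<dots> = (\<Sum>k<m. \<Sum>i<n. \<Sum>j<n. star (B k i * x i) * (B k j * x j))"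
    by (rule sum.swap)
  also have "\<dots> = (\<Sum>k<m. star (\<Sum>i<n. B k i * x i) * (\<Sum>j<n. B k j * x j))"
    by (simp only: sum_product star_sum)
  also have "cstar_pos \<dots>"
    by (intro cstar_pos_sum) auto
  finally show "cstar_pos (kernel_form n M x)" .
qed

text \<open>
  Positivity in \<open>M\<^sub>n(A)\<close> is tested by the quadratic form: a self-adjoint square root of the matrix
  is a factor \<open>B\<close> as required. All later arguments use the quadratic form, on which sums and limits
  are immediate.
\<close>

lemma mat_pos_iff_pos_kernel:
  "mat_pos n (mat n n (\<lambda>(i, j). M i j)) \<longleftrightarrow> pos_kernel n M"
proof
  assume "mat_pos n (mat n n (\<lambda>(i, j). M i j))"
  then obtain B where B: "B \<in> carrier_mat n n" "mat n n (\<lambda>(i, j). M i j) = mat_star B * B"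
    by (auto simp: mat_pos_def)
  show "pos_kernel n M"
  proof (rule pos_kernel_gram)
    fix i j assume "i < n" "j < n"
    then show "M i j = (\<Sum>k<n. star (B $$ (k, i)) * B $$ (k, j))"
      using B(1) arg_cong[OF B(2), of "\<lambda>A. A $$ (i, j)"]
      by (auto simp: mat_star_def scalar_prod_def atLeast0LessThan)
  qed
next
  assume "pos_kernel n M"
  then obtain S where S: "herm_kernel n S" "\<forall>i<n. \<forall>j<n. (\<Sum>l<n. S i l * S l j) = M i j"
    using pos_kernel_sqrt by blast
  let ?B = "mat n n (\<lambda>(i, j). S i j)"
  have "mat n n (\<lambda>(i, j). M i j) = mat_star ?B * ?B"
  proof (rule eq_matI)
    fix i j assume "i < dim_row (mat_star ?B * ?B)" "j < dim_col (mat_star ?B * ?B)"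
    then have ij: "i < n" "j < n" by (auto simp: mat_star_def)
    have "(\<Sum>l<n. star (S l i) * S l j) = (\<Sum>l<n. S i l * S l j)"
      using S(1) ij by (intro sum.cong refl) (simp add: herm_kernel_def)
    with S(2) ij have "(\<Sum>l<n. star (S l i) * S l j) = M i j"
      by simp
    then show "mat n n (\<lambda>(i, j). M i j) $$ (i, j) = (mat_star ?B * ?B) $$ (i, j)"
      using ij by (simp add: mat_star_def scalar_prod_def atLeast0LessThan)
  qed (auto simp: mat_star_def)
  then show "mat_pos n (mat n n (\<lambda>(i, j). M i j))"
    unfolding mat_pos_def by (intro bexI[of _ ?B]) auto
qed

section \<open>Schur products and entrywise exponentials\<close>

lemma pos_kernel_star: "pos_kernel n M \<Longrightarrow> i < n \<Longrightarrow> j < n \<Longrightarrow> star (M i j) = M j i"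
  by (simp add: pos_kernel_def herm_kernel_def)

lemma pos_kernel_cong:
  "(\<And>i j. i < n \<Longrightarrow> j < n \<Longrightarrow> M i j = N i j) \<Longrightarrow> pos_kernel n M \<longleftrightarrow> pos_kernel n N"
  by (simp add: pos_kernel_def herm_kernel_def kernel_form_def)

lemma pos_kernel_add:
  assumes "pos_kernel n M" "pos_kernel n N"
  shows "pos_kernel n (\<lambda>i j. M i j + N i j)"
proof -
  have "kernel_form n (\<lambda>i j. M i j + N i j) x = kernel_form n M x + kernel_form n N x" for x
    by (simp add: kernel_form_def algebra_simps sum.distrib)
  then show ?thesis
    using assms by (auto simp: pos_kernel_def herm_kernel_def star_add intro: cstar_pos_add)
qed

lemma pos_kernel_scaleR:
  assumes "pos_kernel n M" "r \<ge> 0"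
  shows "pos_kernel n (\<lambda>i j. r *\<^sub>R M i j)"
proof -
  have "kernel_form n (\<lambda>i j. r *\<^sub>R M i j) x = r *\<^sub>R kernel_form n M x" for x
    by (simp add: kernel_form_def scaleR_sum_right)
  then show ?thesis
    using assms by (auto simp: pos_kernel_def herm_kernel_def star_scaleR intro: cstar_pos_scaleR)
qed

lemma pos_kernel_sum:
  assumes "\<And>k. k < (m::nat) \<Longrightarrow> pos_kernel n (M k)"
  shows "pos_kernel n (\<lambda>i j. \<Sum>k<m. M k i j)"
  using assms
proof (induction m)
  case 0
  then show ?case by (simp add: pos_kernel_def herm_kernel_def kernel_form_def)
qed (simp add: pos_kernel_add)

lemma pos_kernel_conj:
  assumes "pos_kernel n M"
  shows "pos_kernel n (\<lambda>i j. star (d i) * M i j * d j)"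
proof -
  have "kernel_form n (\<lambda>i j. star (d i) * M i j * d j) x = kernel_form n M (\<lambda>i. d i * x i)" for x
    by (simp add: kernel_form_def star_mult mult.assoc)
  then show ?thesis
    using assms by (auto simp: pos_kernel_def herm_kernel_def star_mult star_star mult.assoc)
qed

lemma pos_kernel_limit:
  assumes lim: "\<And>i j. i < n \<Longrightarrow> j < n \<Longrightarrow> ((\<lambda>t. f t i j) \<longlongrightarrow> M i j) F"
    and F: "F \<noteq> bot" and pos: "\<forall>\<^sub>F t in F. pos_kernel n (f t)"
  shows "pos_kernel n M"
  unfolding pos_kernel_def herm_kernel_def
proof (intro conjI allI impI)
  fix i j assume ij: "i < n" "j < n"
  have "((\<lambda>t. star (f t i j)) \<longlongrightarrow> star (M i j)) F"
    by (rule bounded_linear.tendsto[OF bounded_linear_star lim[OF ij]])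
  moreover have "((\<lambda>t. star (f t i j)) \<longlongrightarrow> M j i) F"
    by (rule Lim_transform_eventually[OF lim[OF ij(2,1)]])
      (use pos in \<open>auto elim!: eventually_mono simp: pos_kernel_star ij\<close>)
  ultimately show "star (M i j) = M j i"
    by (rule tendsto_unique[OF F])
next
  fix x
  show "cstar_pos (kernel_form n M x)"
  proof (rule cstar_pos_limit[OF _ F])
    show "((\<lambda>t. kernel_form n (f t) x) \<longlongrightarrow> kernel_form n M x) F"
      unfolding kernel_form_def by (intro tendsto_intros lim) auto
    show "\<forall>\<^sub>F t in F. cstar_pos (kernel_form n (f t) x)"
      using pos by (auto elim!: eventually_mono simp: pos_kernel_def)
  qed
qed

text \<open>
  With the central square root \<open>S\<close> of \<open>L\<close>, so that \<open>L\<^sub>i\<^sub>j = \<Sum>\<^sub>k S\<^sub>k\<^sub>i\<^sup>* S\<^sub>k\<^sub>j\<close>, the quadratic form of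
  the entrywise product at \<open>x\<close> is the sum over \<open>k\<close> of the form of \<open>N\<close> at the vectors
  \<open>S\<^sub>k\<^sub>i x\<^sub>i\<close>. Centrality lets the two factors of \<open>L\<^sub>i\<^sub>j\<close> move to either side of \<open>N\<^sub>i\<^sub>j\<close>;
  without it the entrywise product need not even be self-adjoint.
\<close>

lemma pos_kernel_schur:
  assumes L: "pos_kernel n L" and N: "pos_kernel n N"
    and central: "\<And>i j. i < n \<Longrightarrow> j < n \<Longrightarrow> L i j \<in> cstar_center"
  shows "pos_kernel n (\<lambda>i j. L i j * N i j)"
  unfolding pos_kernel_def herm_kernel_def
proof (intro conjI allI impI)
  fix i j assume ij: "i < n" "j < n"
  then have "star (L i j * N i j) = N j i * L j i"
    using L N by (simp add: star_mult pos_kernel_star)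
  also have "\<dots> = L j i * N j i"
    using central ij by (simp add: cstar_center_def)
  finally show "star (L i j * N i j) = L j i * N j i" .
next
  fix x
  obtain S where S: "herm_kernel n S" "\<forall>i<n. \<forall>j<n. (\<Sum>l<n. S i l * S l j) = L i j"
    "\<forall>y. (\<forall>i<n. \<forall>j<n. y * L i j = L i j * y) \<longrightarrow> (\<forall>i<n. \<forall>j<n. y * S i j = S i j * y)"
    using pos_kernel_sqrt[OF L] by blast
  have comm: "S i j * y = y * S i j" if "i < n" "j < n" for i j y
    using S(3) central that by (simp add: cstar_center_def)
  have summand: "star (S k i * x i) * N i j * (S k j * x j) = star (x i) * (S i k * S k j * N i j) * x j"
    if "i < n" "j < n" "k < n" for i j k
  proof -
    have "star (S k i * x i) * N i j * (S k j * x j)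
        = star (x i) * (S i k * (N i j * S k j)) * x j"
      using S(1) that by (simp add: star_mult herm_kernel_def mult.assoc)
    also have "N i j * S k j = S k j * N i j"
      using that by (simp add: comm)
    finally show ?thesis
      by (simp add: mult.assoc)
  qed
  have "kernel_form n (\<lambda>i j. L i j * N i j) x
      = (\<Sum>i<n. \<Sum>j<n. \<Sum>k<n. star (S k i * x i) * N i j * (S k j * x j))"
    unfolding kernel_form_def
  proof (intro sum.cong refl)
    fix i j assume "i \<in> {..<n}" "j \<in> {..<n}"
    then have ij: "i < n" "j < n" by auto
    have "(\<Sum>k<n. star (S k i * x i) * N i j * (S k j * x j))
        = (\<Sum>k<n. star (x i) * (S i k * S k j * N i j) * x j)"
      using ij by (intro sum.cong refl summand) auto
    also have "\<dots> = star (x i) * ((\<Sum>k<n. S i k * S k j) * N i j) * x j"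
      by (simp add: sum_distrib_left sum_distrib_right)
    finally show "star (x i) * (L i j * N i j) * x j
        = (\<Sum>k<n. star (S k i * x i) * N i j * (S k j * x j))"
      using S(2) ij by simp
  qed
  also have "\<dots> = (\<Sum>i<n. \<Sum>k<n. \<Sum>j<n. star (S k i * x i) * N i j * (S k j * x j))"
    by (intro sum.cong refl sum.swap)
  also have "\<dots> = (\<Sum>k<n. kernel_form n N (\<lambda>i. S k i * x i))"
    unfolding kernel_form_def by (rule sum.swap)
  also have "cstar_pos \<dots>"
    using N by (intro cstar_pos_sum) (simp add: pos_kernel_def)
  finally show "cstar_pos (kernel_form n (\<lambda>i j. L i j * N i j) x)" .
qed

lemma pos_kernel_power:
  assumes "pos_kernel n L" "\<And>i j. i < n \<Longrightarrow> j < n \<Longrightarrow> L i j \<in> cstar_center"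
  shows "pos_kernel n (\<lambda>i j. L i j ^ k)"
proof (induction k)
  case 0
  show ?case
    by (rule pos_kernel_gram[where m = "Suc 0" and B = "\<lambda>_ _. 1"]) (simp add: lessThan_Suc)
next
  case (Suc k)
  then show ?case
    using pos_kernel_schur[OF assms(1) Suc assms(2)] by simp
qed

lemma pos_kernel_exp:
  assumes "pos_kernel n L" "\<And>i j. i < n \<Longrightarrow> j < n \<Longrightarrow> L i j \<in> cstar_center"
  shows "pos_kernel n (\<lambda>i j. exp (L i j))"
proof (rule pos_kernel_limit[where F = sequentially])
  show "(\<lambda>m. \<Sum>k<m. L i j ^ k /\<^sub>R fact k) \<longlonglongrightarrow> exp (L i j)" for i j
    using exp_converges[of "L i j"] by (simp add: sums_def)
  show "\<forall>\<^sub>F m in sequentially. pos_kernel n (\<lambda>i j. \<Sum>k<m. L i j ^ k /\<^sub>R fact k)"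
    using assms by (intro always_eventually allI pos_kernel_sum pos_kernel_scaleR pos_kernel_power) auto
qed simp

lemma bounded_linear_exp:
  fixes f :: "'a::{real_normed_algebra_1,banach} \<Rightarrow> 'a"
  assumes "bounded_linear f" "\<And>n. f (x ^ n) = f x ^ n"
  shows "f (exp x) = exp (f x)"
  unfolding exp_def
  by (subst bounded_linear.suminf[OF assms(1) summable_exp_generic])
    (simp add: linear_scale[OF bounded_linear.linear[OF assms(1)]] assms(2))

lemma star_exp: "star (exp x) = exp (star x)"
  by (intro bounded_linear_exp bounded_linear_star star_power)

lemma exp_difference_quotient:
  fixes x :: "'a::{real_normed_algebra_1,banach}"
  shows "((\<lambda>t::real. (1/t) *\<^sub>R (exp (- (t *\<^sub>R x)) - 1)) \<longlongrightarrow> - x) (at_right 0)"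
proof -
  have "((\<lambda>t. exp (t *\<^sub>R (- x))) has_vector_derivative - x) (at_right 0)"
    using exp_scaleR_has_vector_derivative_right[of "- x" 0 "{0<..}"] by simp
  then have "((\<lambda>t. (1 / \<bar>t\<bar>) *\<^sub>R (exp (- (t *\<^sub>R x)) - (1 - t *\<^sub>R x))) \<longlongrightarrow> 0) (at_right (0::real))"
    by (simp add: has_vector_derivative_def has_derivative_within)
  then have "((\<lambda>t. (1/t) *\<^sub>R (exp (- (t *\<^sub>R x)) - 1) + x) \<longlongrightarrow> 0) (at_right (0::real))"
    by (rule Lim_transform_eventually)
      (use eventually_at_right_less[of "0::real"] in eventually_elim, simp add: algebra_simps)
  from tendsto_diff[OF this tendsto_const[of x]] show ?thesis
    by simp
qed

section \<open>Conditionally negative kernels\<close>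

definition cond_neg_kernel :: "nat \<Rightarrow> (nat \<Rightarrow> nat \<Rightarrow> 'a::cstar_algebra) \<Rightarrow> bool" where
  "cond_neg_kernel n K \<longleftrightarrow> herm_kernel n K \<and>
    (\<forall>b. (\<Sum>i<n. b i) = 0 \<longrightarrow> cstar_pos (- kernel_form n K b))"

text \<open>
  The difference quotients of \<open>exp (- t K\<^sub>i\<^sub>j)\<close> at \<open>t = 0\<close> tend to \<open>- K\<^sub>i\<^sub>j\<close>. On a vector with sum
  \<open>0\<close> the constant matrix \<open>1\<close> has vanishing form, so the form of the difference quotient is
  positive for every \<open>t > 0\<close>, and the cone is closed.
\<close>

lemma cond_neg_kernel_if_exp_pos:
  assumes pos: "\<And>t::real. t > 0 \<Longrightarrow> pos_kernel n (\<lambda>i j. exp (- (t *\<^sub>R K i j)))"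
  shows "cond_neg_kernel n K"
  unfolding cond_neg_kernel_def herm_kernel_def
proof (intro conjI allI impI)
  let ?q = "\<lambda>(t::real) i j. (1/t) *\<^sub>R (exp (- (t *\<^sub>R K i j)) - 1)"
  have ev: "\<forall>\<^sub>F t::real in at_right 0. t > 0"
    by (simp add: eventually_at_right_less)
  {
    fix i j assume ij: "i < n" "j < n"
    have "((\<lambda>t. star (?q t i j)) \<longlongrightarrow> star (- K i j)) (at_right 0)"
      by (rule bounded_linear.tendsto[OF bounded_linear_star exp_difference_quotient])
    moreover have "((\<lambda>t. star (?q t i j)) \<longlongrightarrow> - K j i) (at_right 0)"
    proof (rule Lim_transform_eventually[OF exp_difference_quotient])
      show "\<forall>\<^sub>F t in at_right 0. ?q t j i = star (?q t i j)"
        using ev by eventually_elim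
          (use pos_kernel_star[OF pos ij] in \<open>simp add: star_scaleR star_diff\<close>)
    qed
    ultimately have "star (- K i j) = - K j i"
      by (rule tendsto_unique[OF trivial_limit_at_right_real])
    then show "star (K i j) = K j i"
      by (simp add: star_minus)
  }
  fix b :: "nat \<Rightarrow> 'a" assume b: "(\<Sum>i<n. b i) = 0"
  show "cstar_pos (- kernel_form n K b)"
  proof (rule cstar_pos_limit)
    have "((\<lambda>t. kernel_form n (?q t) b) \<longlongrightarrow> kernel_form n (\<lambda>i j. - K i j) b) (at_right 0)"
      unfolding kernel_form_def by (intro tendsto_intros exp_difference_quotient)
    then show "((\<lambda>t. kernel_form n (?q t) b) \<longlongrightarrow> - kernel_form n K b) (at_right 0)"
      by (simp add: kernel_form_def sum_negf)
    have ones: "kernel_form n (\<lambda>i j. 1) b = 0"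
      using b by (simp add: kernel_form_def flip: sum_distrib_left)
    show "\<forall>\<^sub>F t in at_right 0. cstar_pos (kernel_form n (?q t) b)"
      using ev
    proof eventually_elim
      case (elim t)
      have "kernel_form n (?q t) b
          = (1/t) *\<^sub>R (kernel_form n (\<lambda>i j. exp (- (t *\<^sub>R K i j))) b - kernel_form n (\<lambda>i j. 1) b)"
        by (simp only: kernel_form_def right_diff_distrib left_diff_distrib sum_subtractf
            scaleR_sum_right mult_scaleR_left mult_scaleR_right scaleR_right_diff_distrib)
      then show ?case
        using pos[OF elim] elim by (simp add: ones pos_kernel_def cstar_pos_scaleR)
    qed
  qed (rule trivial_limit_at_right_real)
qed

lemma cstar_center_closed:
  assumes "x \<in> cstar_center" "y \<in> cstar_center"
  shows "x + y \<in> cstar_center" "x - y \<in> cstar_center"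
  using assms by (simp_all add: cstar_center_def algebra_simps)

lemma cstar_center_scaleR: "x \<in> cstar_center \<Longrightarrow> r *\<^sub>R x \<in> cstar_center"
  by (simp add: cstar_center_def)

text \<open>
  The form of the centred kernel at \<open>x\<close> is minus the form of \<open>K\<close> at the vector that extends \<open>x\<close> by
  the entry \<open>- \<Sum>\<^sub>i x\<^sub>i\<close> at the base point \<open>n\<close>.
\<close>

lemma centered_kernel_pos:
  assumes "cond_neg_kernel (Suc n) K"
  shows "pos_kernel n (\<lambda>i j. K i n + K n j - K i j - K n n)"
  unfolding pos_kernel_def herm_kernel_def
proof (intro conjI allI impI)
  have herm: "star (K i j) = K j i" if "i < Suc n" "j < Suc n" for i j
    using assms that by (simp add: cond_neg_kernel_def herm_kernel_def)
  show "star (K i n + K n j - K i j - K n n) = K j n + K n i - K j i - K n n" if "i < n" "j < n" for i j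
    using that by (simp add: star_add star_diff herm)
  fix x :: "nat \<Rightarrow> 'a"
  let ?s = "\<Sum>i<n. x i" and ?b = "\<lambda>i. if i = n then - (\<Sum>i<n. x i) else x i"
  have "(\<Sum>i<Suc n. ?b i) = 0"
    by simp
  then have "cstar_pos (- kernel_form (Suc n) K ?b)"
    using assms by (simp add: cond_neg_kernel_def del: sum.lessThan_Suc)
  moreover have "kernel_form n (\<lambda>i j. K i n + K n j - K i j - K n n) x = - kernel_form (Suc n) K ?b"
  proof -
    define P Q where "P = (\<Sum>i<n. star (x i) * K i n)" and "Q = (\<Sum>j<n. K n j * x j)"
    have 1: "(\<Sum>i<n. \<Sum>j<n. star (x i) * K i n * x j) = P * ?s"
      by (simp add: P_def sum_product)
    have 2: "(\<Sum>i<n. \<Sum>j<n. star (x i) * K n j * x j) = star ?s * Q"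
      by (simp add: Q_def sum_product star_sum mult.assoc)
    have 3: "(\<Sum>i<n. \<Sum>j<n. star (x i) * K n n * x j) = star ?s * K n n * ?s"
      by (simp only: star_sum sum_distrib_right[of _ _ "K n n"] sum_product)
    have "kernel_form n (\<lambda>i j. K i n + K n j - K i j - K n n) x
        = P * ?s + star ?s * Q - kernel_form n K x - star ?s * K n n * ?s"
      by (simp only: kernel_form_def distrib_left distrib_right right_diff_distrib left_diff_distrib
          sum.distrib sum_subtractf 1 2 3)
    moreover have "kernel_form (Suc n) K ?b
        = kernel_form n K x - P * ?s - star ?s * Q + star ?s * K n n * ?s"
    proof -
      have "kernel_form (Suc n) K ?b = kernel_form n K x + (\<Sum>i<n. star (x i) * K i n * - ?s)
          + ((\<Sum>j<n. star (- ?s) * K n j * x j) + star (- ?s) * K n n * - ?s)"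
        by (simp add: kernel_form_def sum.distrib sum_subtractf sum_negf)
      also have "(\<Sum>i<n. star (x i) * K i n * - ?s) = - (P * ?s)"
        by (simp only: P_def mult_minus_right sum_negf flip: sum_distrib_right)
      also have "(\<Sum>j<n. star (- ?s) * K n j * x j) = - (star ?s * Q)"
        by (simp only: Q_def star_minus mult_minus_left sum_negf mult.assoc flip: sum_distrib_left)
      finally show ?thesis
        by (simp add: star_minus)
    qed
    ultimately show ?thesis
      by simp
  qed
  ultimately show "cstar_pos (kernel_form n (\<lambda>i j. K i n + K n j - K i j - K n n) x)"
    by simp
qed

text \<open>
  Schoenberg's argument. With the centred kernel \<open>L\<close> and
  \<open>a\<^sub>j = t K\<^sub>n\<^sub>n / 2 - t K\<^sub>n\<^sub>j\<close> one has \<open>- t K\<^sub>i\<^sub>j = a\<^sub>i\<^sup>* + t L\<^sub>i\<^sub>j + a\<^sub>j\<close>. All terms commute, so the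
  exponential is \<open>exp(a\<^sub>i)\<^sup>* exp(t L\<^sub>i\<^sub>j) exp(a\<^sub>j)\<close>.
\<close>

lemma exp_pos_if_cond_neg_kernel:
  assumes neg: "cond_neg_kernel (Suc n) K" and t: "t \<ge> 0"
    and central: "\<And>i j. i < Suc n \<Longrightarrow> j < Suc n \<Longrightarrow> K i j \<in> cstar_center"
  shows "pos_kernel n (\<lambda>i j. exp (- (t *\<^sub>R K i j)))"
proof -
  define L where "L i j = t *\<^sub>R (K i n + K n j - K i j - K n n)" for i j
  define a where "a j = (t/2) *\<^sub>R K n n - t *\<^sub>R K n j" for j
  have Lc: "L i j \<in> cstar_center" if "i < n" "j < n" for i j
    unfolding L_def using that by (intro cstar_center_closed cstar_center_scaleR central) auto
  have ac: "a j \<in> cstar_center" if "j < n" for j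
    unfolding a_def using that by (intro cstar_center_closed cstar_center_scaleR central) auto
  have "pos_kernel n (\<lambda>i j. star (exp (a i)) * exp (L i j) * exp (a j))"
    unfolding L_def
    by (intro pos_kernel_conj pos_kernel_exp pos_kernel_scaleR centered_kernel_pos neg t)
      (use Lc in \<open>simp add: L_def\<close>)
  moreover have "star (exp (a i)) * exp (L i j) * exp (a j) = exp (- (t *\<^sub>R K i j))"
    if ij: "i < n" "j < n" for i j
  proof -
    have star_a: "star (a i) = (t/2) *\<^sub>R K n n - t *\<^sub>R K i n"
      using neg ij by (simp add: a_def star_diff star_scaleR cond_neg_kernel_def herm_kernel_def)
    have "exp (star (a i)) * exp (L i j) * exp (a j) = exp (star (a i) + L i j + a j)"
      using Lc[OF ij] ac[OF ij(2)]
      by (simp add: exp_add_commuting cstar_center_def)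
    also have "star (a i) + L i j + a j = - (t *\<^sub>R K i j) + ((t/2) *\<^sub>R K n n + (t/2) *\<^sub>R K n n - t *\<^sub>R K n n)"
      unfolding star_a by (simp add: a_def L_def algebra_simps)
    also have "(t/2) *\<^sub>R K n n + (t/2) *\<^sub>R K n n - t *\<^sub>R K n n = 0"
      by (simp flip: scaleR_add_left)
    finally show ?thesis
      by (simp add: star_exp)
  qed
  ultimately show ?thesis
    by (subst (asm) pos_kernel_cong) auto
qed

section \<open>Automorphisms and the kernels of a group action\<close>

text \<open>
  Boundedness is where positivity enters: \<open>\<parallel>a\<parallel>\<^sup>2 - a\<^sup>* a\<close> has the form \<open>b\<^sup>* b\<close>, hence so has its
  image \<open>\<parallel>a\<parallel>\<^sup>2 - f(a)\<^sup>* f(a)\<close>, and \<open>\<parallel>f(a)\<parallel> \<le> \<parallel>a\<parallel>\<close> follows. Continuity is needed to move \<open>f\<close>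
  through exponentials.
\<close>

lemma star_automorphism_facts:
  assumes "star_automorphism f"
  shows star_automorphism_scaleR: "f (r *\<^sub>R a) = r *\<^sub>R f a"
    and star_automorphism_power: "f (a ^ n) = f a ^ n"
    and star_automorphism_center: "a \<in> cstar_center \<Longrightarrow> f a \<in> cstar_center"
    and star_automorphism_bounded_linear: "bounded_linear f"
proof -
  have add: "f (a + b) = f a + f b" and mult: "f (a * b) = f a * f b" and
    star: "f (star a) = star (f a)" and scale: "f (c *\<^sub>C a) = c *\<^sub>C f a" for a b c
    using assms by (simp_all add: star_automorphism_def)
  have surj: "\<exists>b. a = f b" for a
    using assms by (metis star_automorphism_def bij_is_surj surj_def)
  obtain e where "1 = f e"
    using surj by blast
  then have one: "f 1 = 1"
    using mult[of 1 e] by simp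
  show scaleR: "f (r *\<^sub>R a) = r *\<^sub>R f a" for r a
    using scale[of "complex_of_real r" a] by (simp add: scaleC_of_real)
  show "f (a ^ n) = f a ^ n"
    by (induction n) (simp_all add: one mult)
  show "f a \<in> cstar_center" if "a \<in> cstar_center"
    unfolding cstar_center_def
  proof (intro CollectI allI)
    fix x
    obtain b where "x = f b"
      using surj by blast
    then show "f a * x = x * f a"
      using that by (simp add: cstar_center_def flip: mult)
  qed
  show "bounded_linear f"
  proof (rule bounded_linear_intro[where K = 1])
    fix a
    show "norm (f a) \<le> norm a * 1"
    proof (cases "a = 0")
      case True
      then show ?thesis
        using scaleR[of 0 a] by simp
    next
      case False
      obtain b where b: "(norm a)\<^sup>2 *\<^sub>R 1 - star a * a = star b * b"
        using cstar_pos_norm_minus[of a "norm a"] by (auto simp: cstar_pos_def)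
      have minus: "f (x - y) = f x - f y" for x y
        using add[of x "(-1) *\<^sub>R y"] scaleR[of "-1" y] by simp
      from arg_cong[OF b, of f] have "(norm a)\<^sup>2 *\<^sub>R 1 - star (f a) * f a = star (f b) * f b"
        by (simp add: minus mult star scaleR one)
      then have "cstar_pos ((norm a)\<^sup>2 *\<^sub>R 1 - star (f a) * f a)"
        by (simp add: cstar_pos_star_mult)
      then show ?thesis
        using norm_le_if_cstar_pos[of "norm a" "f a"] False by simp
    qed
  qed (simp_all add: add scaleR)
qed

lemma star_automorphism_exp:
  "star_automorphism f \<Longrightarrow> f (exp (- (t *\<^sub>R x))) = exp (- (t *\<^sub>R f x))"
  using bounded_linear_exp[OF star_automorphism_bounded_linear, of f "(- t) *\<^sub>R x"]
  by (simp add: star_automorphism_power star_automorphism_scaleR[of _ "- t", simplified])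

definition group_kernel ::
    "('g, 'm) monoid_scheme \<Rightarrow> ('g \<Rightarrow> 'a \<Rightarrow> 'a) \<Rightarrow> ('g \<Rightarrow> 'a) \<Rightarrow> (nat \<Rightarrow> 'g) \<Rightarrow> nat \<Rightarrow> nat \<Rightarrow> 'a" where
  "group_kernel G \<alpha> \<psi> g i j = \<alpha> (g i) (\<psi> (inv\<^bsub>G\<^esub> (g i) \<otimes>\<^bsub>G\<^esub> g j))"

lemma positive_definite_iff_pos_kernel:
  "positive_definite G \<alpha> \<phi> \<longleftrightarrow>
    (\<forall>n g. (\<forall>i<n. g i \<in> carrier G) \<longrightarrow> pos_kernel n (group_kernel G \<alpha> \<phi> g))"
  by (simp add: positive_definite_def mat_pos_iff_pos_kernel group_kernel_def[abs_def])

text \<open>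
  The symmetry condition on \<open>\<psi>\<close> amounts to self-adjointness of all the matrices: with
  \<open>h = g\<^sub>i\<^sup>-\<^sup>1 g\<^sub>j\<close> one applies \<open>\<alpha>\<close> of \<open>g\<^sub>i\<close> to it, and conversely one uses the matrix of the two
  elements \<open>1, h\<close>.
\<close>

lemma negative_definite_iff_cond_neg_kernel:
  assumes "cstar_action G \<alpha>"
  shows "negative_definite G \<alpha> \<psi> \<longleftrightarrow>
    (\<forall>n g. (\<forall>i<n. g i \<in> carrier G) \<longrightarrow> cond_neg_kernel n (group_kernel G \<alpha> \<psi> g))"
proof -
  interpret group_action G UNIV \<alpha>
    using assms by (simp add: cstar_action_def)
  interpret group G
    using group_hom by (simp add: group_hom_def)
  have id: "\<alpha> \<one>\<^bsub>G\<^esub> x = x" for x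
    using fun_cong[OF id_eq_one, of x] by simp
  have herm: "(\<forall>g\<in>carrier G. \<alpha> g (\<psi> (inv\<^bsub>G\<^esub> g)) = star (\<psi> g)) \<longleftrightarrow>
    (\<forall>n g. (\<forall>i<n. g i \<in> carrier G) \<longrightarrow> herm_kernel n (group_kernel G \<alpha> \<psi> g))"
  proof (intro iffI allI ballI impI)
    fix n :: nat and g :: "nat \<Rightarrow> 'a"
    assume sym: "\<forall>g\<in>carrier G. \<alpha> g (\<psi> (inv\<^bsub>G\<^esub> g)) = star (\<psi> g)" and g: "\<forall>i<n. g i \<in> carrier G"
    show "herm_kernel n (group_kernel G \<alpha> \<psi> g)"
      unfolding herm_kernel_def
    proof (intro allI impI)
      fix i j assume "i < n" "j < n"
      then have gc: "g i \<in> carrier G" "g j \<in> carrier G"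
        using g by auto
      let ?h = "inv\<^bsub>G\<^esub> (g i) \<otimes>\<^bsub>G\<^esub> g j"
      have h: "?h \<in> carrier G" "inv\<^bsub>G\<^esub> ?h = inv\<^bsub>G\<^esub> (g j) \<otimes>\<^bsub>G\<^esub> g i" "g i \<otimes>\<^bsub>G\<^esub> ?h = g j"
        using gc by (simp_all add: inv_mult_group flip: m_assoc)
      have "star (group_kernel G \<alpha> \<psi> g i j) = \<alpha> (g i) (star (\<psi> ?h))"
        using assms gc by (simp add: group_kernel_def cstar_action_def star_automorphism_def)
      also have "\<dots> = \<alpha> (g i) (\<alpha> ?h (\<psi> (inv\<^bsub>G\<^esub> ?h)))"
        using sym[rule_format, OF h(1)] by simp
      also have "\<dots> = \<alpha> (g i \<otimes>\<^bsub>G\<^esub> ?h) (\<psi> (inv\<^bsub>G\<^esub> ?h))"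
        using gc h(1) by (simp only: composition_rule UNIV_I)
      also have "\<dots> = group_kernel G \<alpha> \<psi> g j i"
        by (simp only: h group_kernel_def)
      finally show "star (group_kernel G \<alpha> \<psi> g i j) = group_kernel G \<alpha> \<psi> g j i" .
    qed
  next
    fix h assume herm: "\<forall>n g. (\<forall>i<n. g i \<in> carrier G) \<longrightarrow> herm_kernel n (group_kernel G \<alpha> \<psi> g)"
      and h: "h \<in> carrier G"
    let ?g = "\<lambda>i::nat. if i = 0 then \<one>\<^bsub>G\<^esub> else h"
    have "herm_kernel 2 (group_kernel G \<alpha> \<psi> ?g)"
      using herm h by simp
    then have "star (group_kernel G \<alpha> \<psi> ?g 0 1) = group_kernel G \<alpha> \<psi> ?g 1 0"
      by (simp add: herm_kernel_def)
    then show "\<alpha> h (\<psi> (inv\<^bsub>G\<^esub> h)) = star (\<psi> h)"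
      using h by (simp add: group_kernel_def id)
  qed
  show ?thesis
    unfolding negative_definite_def herm cond_neg_kernel_def
    by (auto simp: cstar_le_def kernel_form_def group_kernel_def)
qed

theorem theorem3p21:
  fixes G :: "('g, 'm) monoid_scheme"
    and \<alpha> :: "'g \<Rightarrow> 'a::cstar_algebra \<Rightarrow> 'a"
    and \<psi> :: "'g \<Rightarrow> 'a"
  assumes "cstar_action G \<alpha>"
  shows
    "((\<forall>t::real. t > 0 \<longrightarrow> positive_definite G \<alpha> (\<lambda>g. exp (- (t *\<^sub>R \<psi> g))))
        \<longrightarrow> negative_definite G \<alpha> \<psi>) \<and>
     ((\<forall>g \<in> carrier G. \<psi> g \<in> cstar_center) \<longrightarrow>
        (negative_definite G \<alpha> \<psi>
          \<longrightarrow> (\<forall>t::real. t > 0 \<longrightarrow> positive_definite G \<alpha> (\<lambda>g. exp (- (t *\<^sub>R \<psi> g))))) \<and>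
        (negative_definite G \<alpha> \<psi>
          \<longleftrightarrow> (\<forall>t::real. t > 0 \<longrightarrow> positive_definite G \<alpha> (\<lambda>g. exp (- (t *\<^sub>R \<psi> g))))))"
proof -
  let ?N = "negative_definite G \<alpha> \<psi>"
  let ?P = "\<forall>t::real. t > 0 \<longrightarrow> positive_definite G \<alpha> (\<lambda>g. exp (- (t *\<^sub>R \<psi> g)))"
  have "group_action G UNIV \<alpha>"
    using assms by (simp add: cstar_action_def)
  then interpret group G
    by (simp add: group_action_def group_hom_def)
  have aut: "star_automorphism (\<alpha> h)" if "h \<in> carrier G" for h
    using assms that by (simp add: cstar_action_def)
  have kernel_exp: "pos_kernel n (group_kernel G \<alpha> (\<lambda>g. exp (- (t *\<^sub>R \<psi> g))) g) \<longleftrightarrow>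
      pos_kernel n (\<lambda>i j. exp (- (t *\<^sub>R group_kernel G \<alpha> \<psi> g i j)))"
    if "\<forall>i<n. g i \<in> carrier G" for n :: nat and g and t :: real
    using that by (intro pos_kernel_cong) (simp add: group_kernel_def star_automorphism_exp[OF aut])
  have neg_if_pos: ?N if ?P
    unfolding negative_definite_iff_cond_neg_kernel[OF assms]
  proof (intro allI impI)
    fix n :: nat and g :: "nat \<Rightarrow> 'g" assume g: "\<forall>i<n. g i \<in> carrier G"
    show "cond_neg_kernel n (group_kernel G \<alpha> \<psi> g)"
    proof (rule cond_neg_kernel_if_exp_pos)
      fix t :: real assume "t > 0"
      then show "pos_kernel n (\<lambda>i j. exp (- (t *\<^sub>R group_kernel G \<alpha> \<psi> g i j)))"
        using that g kernel_exp[OF g] unfolding positive_definite_iff_pos_kernel by blast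
    qed
  qed
  have pos_if_neg: ?P if neg: ?N and central: "\<forall>g\<in>carrier G. \<psi> g \<in> cstar_center"
    unfolding positive_definite_iff_pos_kernel
  proof (intro allI impI)
    fix t :: real and n :: nat and g :: "nat \<Rightarrow> 'g" assume t: "t > 0" and g: "\<forall>i<n. g i \<in> carrier G"
    \<comment> \<open>The group elements are extended by a base point; any element of the group would do.\<close>
    define h where "h = g(n := \<one>\<^bsub>G\<^esub>)"
    have h: "h i \<in> carrier G" if "i < Suc n" for i
      using g that by (auto simp: h_def less_Suc_eq)
    have "pos_kernel n (\<lambda>i j. exp (- (t *\<^sub>R group_kernel G \<alpha> \<psi> h i j)))"
    proof (rule exp_pos_if_cond_neg_kernel)
      show "cond_neg_kernel (Suc n) (group_kernel G \<alpha> \<psi> h)"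
        using neg h by (simp add: negative_definite_iff_cond_neg_kernel[OF assms])
      show "group_kernel G \<alpha> \<psi> h i j \<in> cstar_center" if "i < Suc n" "j < Suc n" for i j
      proof -
        have "inv\<^bsub>G\<^esub> (h i) \<otimes>\<^bsub>G\<^esub> h j \<in> carrier G"
          using h that by simp
        then show ?thesis
          unfolding group_kernel_def
          using central aut[OF h[OF that(1)]] by (simp add: star_automorphism_center)
      qed
    qed (use t in simp)
    then have "pos_kernel n (\<lambda>i j. exp (- (t *\<^sub>R group_kernel G \<alpha> \<psi> g i j)))"
      by (subst (asm) pos_kernel_cong) (auto simp: group_kernel_def h_def)
    then show "pos_kernel n (group_kernel G \<alpha> (\<lambda>g. exp (- (t *\<^sub>R \<psi> g))) g)"
      by (simp only: kernel_exp[OF g])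
  qed
  show ?thesis
    using neg_if_pos pos_if_neg by blast
qed

end
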